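(* Fix $p$, the finite alphabet $\mathcal{X}$, the symmetric function $f:\mathcal{X}^p\to\mathbb{R}$, the sets $A_n\subset\mathcal{X}^n$, the kernels $\kappa,\kappa_1,\kappa_2$ and the bound $B_U$ as in the context, and let $$V_n=\frac1n\max_{\underline\sigma\in A_n}\sum_{i_1\neq\cdots\neq i_p}A_{i_1,\dots,i_p}f(\sigma_{i_1},\dots,\sigma_{i_p}),$$ and, for $\alpha\in\mathbb{R}$, $$T_n^\alpha=\frac1n\max\Big\{\sum_{i_1\neq\cdots\neq i_p}\frac{J_{i_1,\dots,i_p}}{n^{(p-1)/2}}f(\sigma_{i_1},\dots,\sigma_{i_p}) : \underline\sigma\in A_n,\ \frac1{n^p}\sum_{i_1\neq\cdots\neq i_p}\kappa_1(i_1,\dots,i_p)f(\sigma_{i_1},\dots,\sigma_{i_p})=\alpha\Big\}.$$ Then, for $d$ sufficiently large, with high probability as $n\to\infty$, $$V_n=\mathbb{E}\Big[\max_\alpha\big(\alpha d+T_n^\alpha\sqrt d\big)\Big]+o_d(\sqrt d).$$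
   Context: Setting. $p\ge 2$ is a fixed integer, $\mathcal{X}$ is a finite set, and $f:\mathcal{X}^p\to\mathbb{R}$ is symmetric (invariant under permutations of its arguments). $A_n\subset\mathcal{X}^n$. Sums over $i_1\neq\cdots\neq i_p$ run over all ordered $p$-tuples of pairwise distinct indices in $\{1,\dots,n\}$. An array indexed by such tuples is symmetric if it is invariant under permutations of the indices. The kernels $\kappa,\kappa_1,\kappa_2:\mathbb{N}^p\to[0,\infty)$ are symmetric, non-negative and bounded, and $d>0$ is a parameter independent of $n$. For each $n$, $\{A_{i_1,\dots,i_p}\}$ is a symmetric array of real random variables such that $\{A_{i_1,\dots,i_p}:1\le i_1<\cdots<i_p\le n\}$ are independent, $|A_{i_1,\dots,i_p}|\le B_U$ for a constant $B_U$, and $$\mathbb{P}[A_{i_1,\dots,i_p}\neq0]=d\,\frac{\kappa(i_1,\dots,i_p)}{n^{p-1}},\quad \mathbb{E}[A_{i_1,\dots,i_p}]=d\,\frac{\kappa_1(i_1,\dots,i_p)}{n^{p-1}},\quad \mathbb{E}[A_{i_1,\dots,i_p}^2]=d\,\frac{\kappa_2(i_1,\dots,i_p)}{n^{p-1}}.$$ $\{J_{i_1,\dots,i_p}\}$ is a symmetric array such that $\{J_{i_1,\dots,i_p}:i_1<\cdots<i_p\}$ are independent with $J_{i_1,\dots,i_p}\sim\mathcal{N}(0,\kappa_2(i_1,\dots,i_p))$. Conventions. The maximum over an empty set is $-\infty$. "With high probability" means with probability tending to $1$ as $n\to\infty$. A sequence of random variables $Z_n$ (depending on $d$) is $o_d(\sqrt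 d)$ with high probability if there is a deterministic function $g(d)$ with $g(d)/\sqrt d\to0$ as $d\to\infty$ such that $\mathbb{P}[|Z_n|\le g(d)]\to1$ as $n\to\infty$. *)

theory Defs
  imports "HOL-Probability.Probability" "HOL-Combinatorics.Permutations"
begin

text \<open>A \<open>p\<close>-tuple is a list of length \<open>p\<close>; a function of \<open>p\<close> arguments and an array with \<open>p\<close>
  indices are functions on lists. A configuration in \<open>X\<^sup>n\<close> is an element of
  \<open>{1..n} \<rightarrow>\<^sub>E X\<close>.\<close>

definition symmetric_on :: "'a list set \<Rightarrow> ('a list \<Rightarrow> 'b) \<Rightarrow> bool" where
  "symmetric_on D F \<longleftrightarrow>
     (\<forall>xs\<in>D. \<forall>\<pi>. \<pi> permutes {..<length xs} \<longrightarrow> F (permute_list \<pi> xs) = F xs)"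

definition distinct_tuples :: "nat \<Rightarrow> nat \<Rightarrow> nat list set" where
  "distinct_tuples p n = {is. length is = p \<and> set is \<subseteq> {1..n} \<and> distinct is}"

definition increasing_tuples :: "nat \<Rightarrow> nat \<Rightarrow> nat list set" where
  "increasing_tuples p n = {is. length is = p \<and> set is \<subseteq> {1..n} \<and> sorted_wrt (<) is}"

definition symmetric_kernel :: "nat \<Rightarrow> (nat list \<Rightarrow> real) \<Rightarrow> bool" where
  "symmetric_kernel p k \<longleftrightarrow>
     symmetric_on {is. length is = p} k \<and>
     (\<forall>is. length is = p \<longrightarrow> 0 \<le> k is) \<and>
     (\<exists>C. \<forall>is. length is = p \<longrightarrow> k is \<le> C)"

definition symmetric_array ::
    "'w measure \<Rightarrow> nat \<Rightarrow> nat \<Rightarrow> (nat list \<Rightarrow> 'w \<Rightarrow> real) \<Rightarrow> bool" where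
  "symmetric_array M p n Y \<longleftrightarrow>
     (\<forall>\<omega>\<in>space M. symmetric_on (distinct_tuples p n) (\<lambda>is. Y is \<omega>)) \<and>
     prob_space.indep_vars M (\<lambda>_. borel) Y (increasing_tuples p n)"

definition sparse_array ::
    "'w measure \<Rightarrow> nat \<Rightarrow> nat \<Rightarrow> real \<Rightarrow> (nat list \<Rightarrow> real) \<Rightarrow> (nat list \<Rightarrow> real) \<Rightarrow>
     (nat list \<Rightarrow> real) \<Rightarrow> real \<Rightarrow> (nat list \<Rightarrow> 'w \<Rightarrow> real) \<Rightarrow> bool" where
  "sparse_array M p n d \<kappa> \<kappa>\<^sub>1 \<kappa>\<^sub>2 B A \<longleftrightarrow>
     prob_space M \<and> symmetric_array M p n A \<and>
     (\<forall>is\<in>distinct_tuples p n.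
        (AE \<omega> in M. \<bar>A is \<omega>\<bar> \<le> B) \<and>
        measure M {\<omega>\<in>space M. A is \<omega> \<noteq> 0} = d * (\<kappa> is / real n ^ (p - 1)) \<and>
        (\<integral>\<omega>. A is \<omega> \<partial>M) = d * (\<kappa>\<^sub>1 is / real n ^ (p - 1)) \<and>
        (\<integral>\<omega>. (A is \<omega>)\<^sup>2 \<partial>M) = d * (\<kappa>\<^sub>2 is / real n ^ (p - 1)))"

text \<open>\<open>normal_density\<close> with standard deviation \<open>0\<close> is the zero function, so the degenerate
  Gaussian law needs its own case.\<close>

definition gaussian :: "real \<Rightarrow> real \<Rightarrow> real measure" where
  "gaussian m v =
     (if v = 0 then return borel m
      else density lborel (\<lambda>x. ennreal (normal_density m (sqrt v) x)))"

definition gaussian_array ::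
    "'w measure \<Rightarrow> nat \<Rightarrow> nat \<Rightarrow> (nat list \<Rightarrow> real) \<Rightarrow> (nat list \<Rightarrow> 'w \<Rightarrow> real) \<Rightarrow> bool" where
  "gaussian_array M p n \<kappa>\<^sub>2 J \<longleftrightarrow>
     prob_space M \<and> symmetric_array M p n J \<and>
     (\<forall>is\<in>distinct_tuples p n. distr M borel (J is) = gaussian 0 (\<kappa>\<^sub>2 is))"

definition tuple_sum ::
    "nat \<Rightarrow> nat \<Rightarrow> ('x list \<Rightarrow> real) \<Rightarrow> (nat list \<Rightarrow> real) \<Rightarrow> (nat \<Rightarrow> 'x) \<Rightarrow> real" where
  "tuple_sum p n f a \<sigma> = (\<Sum>is\<in>distinct_tuples p n. a is * f (map \<sigma> is))"

text \<open>Maxima are taken in the extended reals, where the supremum of the empty set is \<open>-\<infinity>\<close>;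
  the suprema over configurations are over finite sets.\<close>

definition V_n ::
    "nat \<Rightarrow> nat \<Rightarrow> ('x list \<Rightarrow> real) \<Rightarrow> (nat \<Rightarrow> 'x) set \<Rightarrow> (nat list \<Rightarrow> real) \<Rightarrow> ereal" where
  "V_n p n f S a = (SUP \<sigma>\<in>S. ereal (tuple_sum p n f a \<sigma>)) / ereal (real n)"

definition T_n ::
    "nat \<Rightarrow> nat \<Rightarrow> ('x list \<Rightarrow> real) \<Rightarrow> (nat \<Rightarrow> 'x) set \<Rightarrow> (nat list \<Rightarrow> real) \<Rightarrow>
     (nat list \<Rightarrow> real) \<Rightarrow> real \<Rightarrow> ereal" where
  "T_n p n f S \<kappa>\<^sub>1 j \<alpha> =
     (SUP \<sigma>\<in>{\<sigma>\<in>S. 1 / real n ^ p * tuple_sum p n f \<kappa>\<^sub>1 \<sigma> = \<alpha>}.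
        ereal (tuple_sum p n f (\<lambda>is. j is / real n powr ((real p - 1) / 2)) \<sigma>)) / ereal (real n)"

text \<open>Expectation of an extended-real-valued random variable, as the difference of the integrals
  of its positive and negative parts (\<open>e2ennreal\<close> sends negative values to \<open>0\<close>). It is \<open>-\<infinity>\<close> for
  the constant \<open>-\<infinity>\<close> and the usual expectation for an integrable real random variable.\<close>

definition ereal_expectation :: "'w measure \<Rightarrow> ('w \<Rightarrow> ereal) \<Rightarrow> ereal" where
  "ereal_expectation M Y =
     enn2ereal (\<integral>\<^sup>+\<omega>. e2ennreal (Y \<omega>) \<partial>M) - enn2ereal (\<integral>\<^sup>+\<omega>. e2ennreal (- Y \<omega>) \<partial>M)"

text \<open>\<open>Z d n\<close> is \<open>o\<^sub>d(\<surd>d)\<close> with high probability as \<open>n \<rightarrow> \<infinity>\<close>, for all sufficiently large \<open>d\<close>.\<close>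

definition small_o_sqrt_whp ::
    "(real \<Rightarrow> nat \<Rightarrow> 'w measure) \<Rightarrow> (real \<Rightarrow> nat \<Rightarrow> 'w \<Rightarrow> real) \<Rightarrow> bool" where
  "small_o_sqrt_whp M Z \<longleftrightarrow>
     (\<exists>g :: real \<Rightarrow> real. ((\<lambda>d. g d / sqrt d) \<longlongrightarrow> 0) at_top \<and>
        (\<forall>\<^sub>F d in at_top.
           (\<lambda>n. measure (M d n) {\<omega>\<in>space (M d n). \<bar>Z d n \<omega>\<bar> \<le> g d}) \<longlonglongrightarrow> 1))"

end

theory Submission
  imports Defs
begin

text \<open>
  The Gaussian variational formula is the maximum of the same functional that defines the sparse
  problem. In \<open>\<alpha> d + T\<^sup>\<alpha> \<surd>d\<close> the number \<open>\<alpha> d\<close> is the contribution of the deterministic couplings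
  \<open>d \<kappa>\<^sub>1 / n\<^bsup>p-1\<^esup>\<close>, so maximising over \<open>\<alpha>\<close> and over the configurations at level \<open>\<alpha>\<close> amounts to one
  maximisation over all configurations, with the couplings
  \<open>Y\<^sub>e = d \<kappa>\<^sub>1(e) / n\<^bsup>p-1\<^esup> + \<surd>d J\<^sub>e / n\<^bsup>(p-1)/2\<^esup>\<close> in place of \<open>A\<^sub>e\<close> (lemma \<open>SUP_level_eq_ground_value\<close>).
  The variables \<open>A\<^sub>e\<close> and \<open>Y\<^sub>e\<close> have the same mean, and their second moments differ by the square of
  that mean only. The theorem is therefore a universality statement, proved by Lindeberg's
  replacement argument together with a concentration bound.

  The maximum is not smooth. It is replaced by the free energy at inverse temperature \<open>\<beta>\<close>, which
  after division by \<open>n\<close> costs \<open>ln |X| / \<beta>\<close>, because there are at most \<open>|X|\<^sup>n\<close> configurations. As a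
  function of a single coupling the free energy is a log partition function; its second and third
  derivatives are cumulants of a bounded quantity, of order \<open>\<beta>\<close> and \<open>\<beta>\<^sup>2\<close>
  (\<open>log_partition_taylor\<close>). When the \<open>A\<^sub>e\<close> are exchanged for the \<open>Y\<^sub>e\<close> one at a time, the first two
  moments therefore cancel up to the negligible mismatch, and what remains are the third moments.
  As the couplings are bounded, \<open>E|A\<^sub>e|\<^sup>3\<close> is at most \<open>|B\<^sub>U| d \<kappa>\<^sub>2 / n\<^bsup>p-1\<^esup>\<close>; summed over the at most
  \<open>n\<^sup>p\<close> tuples and divided by \<open>n\<close> this contributes \<open>O(\<beta>\<^sup>2 d)\<close>. The third moments of the \<open>Y\<^sub>e\<close> and the
  mismatch of the second moments contribute terms that vanish as \<open>n\<close> grows with \<open>d\<close> fixed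
  (\<open>max_linear_lindeberg\<close>, \<open>ground_value_interpolation\<close>). With \<open>\<beta> = d\<^bsup>-1/3\<^esup>\<close> both errors are
  \<open>O(d\<^bsup>1/3\<^esup>)\<close>, which is \<open>o(\<surd>d)\<close>.

  Finally, the sparse maximum is Lipschitz in each coupling, so an Efron--Stein argument
  (\<open>variance_coordinate_lipschitz\<close>) bounds the variance of \<open>V\<^sub>n\<close> by \<open>O(d / n)\<close>, and Chebyshev's
  inequality replaces \<open>V\<^sub>n\<close> by its expectation.
\<close>

section \<open>Lipschitz functions of independent coordinates\<close>

locale square_integrable_laws =
  fixes \<mu> :: "'i \<Rightarrow> real measure"
  assumes prob_law: "\<And>i. prob_space (\<mu> i)"
    and sets_law [measurable_cong]: "\<And>i. sets (\<mu> i) = sets borel"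
    and square_integrable_law: "\<And>i. integrable (\<mu> i) (\<lambda>t. t\<^sup>2)"
begin

sublocale product_sigma_finite \<mu>
  by (simp add: product_sigma_finite.intro prob_law prob_space_imp_sigma_finite)

lemma sets_PiM_laws: "sets (Pi\<^sub>M I \<mu>) = sets (Pi\<^sub>M I (\<lambda>_. borel))"
  by (rule sets_PiM_cong) (auto simp: sets_law)

lemma integrable_law: "integrable (\<mu> i) (\<lambda>t. t)"
proof -
  interpret P: prob_space "\<mu> i" by (rule prob_law)
  show ?thesis by (rule P.square_integrable_imp_integrable[OF _ square_integrable_law]) simp
qed

lemma integrable_coordinate:
  assumes "i \<in> I" and [measurable]: "g \<in> borel_measurable borel" and "integrable (\<mu> i) g"
  shows "integrable (Pi\<^sub>M I \<mu>) (\<lambda>x. g (x i) :: real)"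
proof -
  have "distr (Pi\<^sub>M I \<mu>) (\<mu> i) (\<lambda>x. x i) = \<mu> i"
    by (rule distr_PiM_component) (use assms prob_law in auto)
  then show ?thesis
    using integrable_distr_eq[of "\<lambda>x. x i" "Pi\<^sub>M I \<mu>" "\<mu> i" g] assms by simp
qed

end

text \<open>The bound is required for all functions \<open>x\<close> and \<open>y\<close>, hence it forces \<open>F\<close> to depend on the
  coordinates in \<open>I\<close> only. The class is closed under fixing a coordinate and under integrating it
  out, which is what both inductions over coordinates below rest on.\<close>
definition coordinate_lipschitz :: "'i set \<Rightarrow> ('i \<Rightarrow> real) \<Rightarrow> (('i \<Rightarrow> real) \<Rightarrow> real) \<Rightarrow> bool" where
  "coordinate_lipschitz I c F \<longleftrightarrow>
     F \<in> borel_measurable (Pi\<^sub>M I (\<lambda>_. borel)) \<and>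
     (\<forall>x y. \<bar>F x - F y\<bar> \<le> (\<Sum>i\<in>I. c i * \<bar>x i - y i\<bar>))"

lemma coordinate_lipschitz_update:
  assumes "coordinate_lipschitz (insert i I) c F" "finite I" "i \<notin> I"
  shows "\<bar>F (x(i := s)) - F (x(i := t))\<bar> \<le> c i * \<bar>s - t\<bar>"
proof -
  have "(\<Sum>j\<in>insert i I. c j * \<bar>(x(i := s)) j - (x(i := t)) j\<bar>) = c i * \<bar>s - t\<bar>"
    using assms(2,3) by (simp add: sum.insert) (rule sum.neutral, auto)
  then show ?thesis using assms(1) unfolding coordinate_lipschitz_def by metis
qed

lemma measurable_update_pair:
  assumes "i \<notin> I" "F \<in> borel_measurable (Pi\<^sub>M (insert i I) (\<lambda>_. borel))"
  shows "(\<lambda>(x, t). F (x(i := t))) \<in> borel_measurable (Pi\<^sub>M I (\<lambda>_. borel) \<Otimes>\<^sub>M borel)"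
  using measurable_comp[OF measurable_add_dim assms(2)] by (simp add: comp_def case_prod_beta')

context square_integrable_laws
begin

text \<open>A Lipschitz function grows at most linearly, so its square is dominated by a combination of
  the squared coordinates.\<close>
lemma
  assumes "coordinate_lipschitz I c F" "finite I" "\<And>i. i \<in> I \<Longrightarrow> 0 \<le> c i"
  shows integrable_coordinate_lipschitz: "integrable (Pi\<^sub>M I \<mu>) F"
    and integrable_coordinate_lipschitz_square: "integrable (Pi\<^sub>M I \<mu>) (\<lambda>x. (F x)\<^sup>2)"
proof -
  interpret P: prob_space "Pi\<^sub>M I \<mu>" by (rule prob_space_PiM) (rule prob_law)
  have [measurable]: "F \<in> borel_measurable (Pi\<^sub>M I (\<lambda>_. borel))"
    using assms unfolding coordinate_lipschitz_def by auto
  note [measurable_cong] = sets_PiM_laws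
  define b where "b x = (\<Sum>i\<in>I. c i * \<bar>x i\<bar>)" for x
  have bound: "\<bar>F x\<bar> \<le> \<bar>F (\<lambda>_. 0)\<bar> + b x" for x
  proof -
    have "\<bar>F x - F (\<lambda>_. 0)\<bar> \<le> b x"
      using assms(1)[unfolded coordinate_lipschitz_def, THEN conjunct2, rule_format, of x "\<lambda>_. 0"]
      by (simp add: b_def)
    then show ?thesis by linarith
  qed
  have b_nonneg: "0 \<le> b x" for x unfolding b_def by (intro sum_nonneg) (use assms in auto)
  have b_sq: "(b x)\<^sup>2 \<le> real (card I) * (\<Sum>i\<in>I. (c i)\<^sup>2 * (x i)\<^sup>2)" for x
    unfolding b_def using sum_squared_le_sum_of_squares[of "\<lambda>i. c i * \<bar>x i\<bar>" I]
    by (simp add: power_mult_distrib mult.commute)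
  have [measurable]: "(\<lambda>x. x i) \<in> borel_measurable (Pi\<^sub>M I \<mu>)" if "i \<in> I" for i
    using measurable_component_singleton[OF that, of \<mu>]
    unfolding measurable_cong_sets[OF refl sets_law] .
  have int_sq: "integrable (Pi\<^sub>M I \<mu>) (\<lambda>x. 2 * (F (\<lambda>_. 0))\<^sup>2 + 2 * (real (card I) * (\<Sum>i\<in>I. (c i)\<^sup>2 * (x i)\<^sup>2)))"
    by (intro Bochner_Integration.integrable_add integrable_mult_right Bochner_Integration.integrable_sum
        integrable_coordinate[where g = "\<lambda>t. t\<^sup>2"] square_integrable_law) auto
  show sq: "integrable (Pi\<^sub>M I \<mu>) (\<lambda>x. (F x)\<^sup>2)"
  proof (rule Bochner_Integration.integrable_bound[OF int_sq])
    show "AE x in Pi\<^sub>M I \<mu>. norm ((F x)\<^sup>2) \<le>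
        norm (2 * (F (\<lambda>_. 0))\<^sup>2 + 2 * (real (card I) * (\<Sum>i\<in>I. (c i)\<^sup>2 * (x i)\<^sup>2)))"
    proof (rule AE_I2)
      fix x
      have "(F x)\<^sup>2 \<le> (\<bar>F (\<lambda>_. 0)\<bar> + b x)\<^sup>2"
        using bound[of x] b_nonneg[of x] by (metis abs_ge_zero power_mono power2_abs)
      also have "\<dots> \<le> 2 * (F (\<lambda>_. 0))\<^sup>2 + 2 * (b x)\<^sup>2"
        using sum_squares_bound[of "\<bar>F (\<lambda>_. 0)\<bar>" "b x"] by (simp add: power2_sum)
      also have "\<dots> \<le> 2 * (F (\<lambda>_. 0))\<^sup>2 + 2 * (real (card I) * (\<Sum>i\<in>I. (c i)\<^sup>2 * (x i)\<^sup>2))"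
        using b_sq[of x] by simp
      finally show "norm ((F x)\<^sup>2) \<le>
        norm (2 * (F (\<lambda>_. 0))\<^sup>2 + 2 * (real (card I) * (\<Sum>i\<in>I. (c i)\<^sup>2 * (x i)\<^sup>2)))"
        by simp
    qed
  qed measurable
  show "integrable (Pi\<^sub>M I \<mu>) F"
    by (rule P.square_integrable_imp_integrable[OF _ sq]) measurable
qed

lemma coordinate_lipschitz_integral:
  assumes "coordinate_lipschitz (insert i I) c F" "finite I" "i \<notin> I" "0 \<le> c i"
  shows "integrable (\<mu> i) (\<lambda>t. F (x(i := t)))"
    and "integrable (\<mu> i) (\<lambda>t. (F (x(i := t)))\<^sup>2)"
    and "coordinate_lipschitz I c (\<lambda>x. \<integral>t. F (x(i := t)) \<partial>\<mu> i)"
    and "(\<lambda>x. \<integral>t. (F (x(i := t)))\<^sup>2 \<partial>\<mu> i) \<in> borel_measurable (Pi\<^sub>M I (\<lambda>_. borel))"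
proof -
  interpret P: prob_space "\<mu> i" by (rule prob_law)
  have F[measurable]: "F \<in> borel_measurable (Pi\<^sub>M (insert i I) (\<lambda>_. borel))"
    using assms unfolding coordinate_lipschitz_def by auto
  note [measurable] = measurable_update_pair[OF assms(3) F]
  have lip: "\<bar>F (x(i := s)) - F (x(i := t))\<bar> \<le> c i * \<bar>s - t\<bar>" for x s t
    by (rule coordinate_lipschitz_update[OF assms(1-3)])
  have meas: "(\<lambda>t. F (x(i := t))) \<in> borel_measurable (\<mu> i)" for x
  proof -
    have "continuous_on UNIV (\<lambda>t. F (x(i := t)))"
    proof (rule lipschitz_on_continuous_on[where L = "c i"], rule lipschitz_onI)
      show "dist (F (x(i := s))) (F (x(i := t))) \<le> c i * dist s t" for s t
        using lip[of x s t] by (simp add: dist_real_def)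
    qed (fact assms(4))
    then show ?thesis
      unfolding measurable_cong_sets[OF sets_law refl] by (rule borel_measurable_continuous_onI)
  qed
  have int_sq: "integrable (\<mu> i) (\<lambda>t. (F (x(i := t)))\<^sup>2)" for x
  proof (rule Bochner_Integration.integrable_bound)
    show "integrable (\<mu> i) (\<lambda>t. 2 * (F (x(i := 0)))\<^sup>2 + 2 * ((c i)\<^sup>2 * t\<^sup>2))"
      by (intro Bochner_Integration.integrable_add integrable_mult_right square_integrable_law) auto
    show "AE t in \<mu> i. norm ((F (x(i := t)))\<^sup>2) \<le> norm (2 * (F (x(i := 0)))\<^sup>2 + 2 * ((c i)\<^sup>2 * t\<^sup>2))"
    proof (rule AE_I2)
      fix t
      have "\<bar>F (x(i := t))\<bar> \<le> \<bar>F (x(i := 0))\<bar> + c i * \<bar>t\<bar>" using lip[of x t 0] by simp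
      then have "(F (x(i := t)))\<^sup>2 \<le> (\<bar>F (x(i := 0))\<bar> + c i * \<bar>t\<bar>)\<^sup>2"
        by (metis abs_ge_zero power_mono power2_abs)
      also have "\<dots> \<le> 2 * (F (x(i := 0)))\<^sup>2 + 2 * ((c i)\<^sup>2 * t\<^sup>2)"
        using sum_squares_bound[of "\<bar>F (x(i := 0))\<bar>" "c i * \<bar>t\<bar>"]
        by (simp add: power2_sum power_mult_distrib mult.commute)
      finally show "norm ((F (x(i := t)))\<^sup>2) \<le> norm (2 * (F (x(i := 0)))\<^sup>2 + 2 * ((c i)\<^sup>2 * t\<^sup>2))"
        by simp
    qed
  qed (use meas[of x] in measurable)
  show "integrable (\<mu> i) (\<lambda>t. (F (x(i := t)))\<^sup>2)" by (rule int_sq)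
  have int: "integrable (\<mu> i) (\<lambda>t. F (x(i := t)))" for x
    by (rule P.square_integrable_imp_integrable[OF meas int_sq])
  then show "integrable (\<mu> i) (\<lambda>t. F (x(i := t)))" .
  have "\<bar>(\<integral>t. F (x(i := t)) \<partial>\<mu> i) - (\<integral>t. F (y(i := t)) \<partial>\<mu> i)\<bar> \<le> (\<Sum>j\<in>I. c j * \<bar>x j - y j\<bar>)" for x y
  proof -
    have *: "\<bar>F (x(i := t)) - F (y(i := t))\<bar> \<le> (\<Sum>j\<in>I. c j * \<bar>x j - y j\<bar>)" for t
    proof -
      have "(\<Sum>j\<in>insert i I. c j * \<bar>(x(i := t)) j - (y(i := t)) j\<bar>) = (\<Sum>j\<in>I. c j * \<bar>x j - y j\<bar>)"
        using assms(2,3) by (simp add: sum.insert) (rule sum.cong, auto)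
      then show ?thesis using assms(1) unfolding coordinate_lipschitz_def by metis
    qed
    have "\<bar>(\<integral>t. F (x(i := t)) \<partial>\<mu> i) - (\<integral>t. F (y(i := t)) \<partial>\<mu> i)\<bar> = \<bar>\<integral>t. F (x(i := t)) - F (y(i := t)) \<partial>\<mu> i\<bar>"
      using int by simp
    also have "\<dots> \<le> (\<integral>t. \<bar>F (x(i := t)) - F (y(i := t))\<bar> \<partial>\<mu> i)"
      by (rule integral_abs_bound)
    also have "\<dots> \<le> (\<integral>t. (\<Sum>j\<in>I. c j * \<bar>x j - y j\<bar>) \<partial>\<mu> i)"
      by (intro integral_mono integrable_abs Bochner_Integration.integrable_diff int * P.integrable_const)
    also have "\<dots> = (\<Sum>j\<in>I. c j * \<bar>x j - y j\<bar>)" by (simp add: P.prob_space)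
    finally show ?thesis .
  qed
  then show "coordinate_lipschitz I c (\<lambda>x. \<integral>t. F (x(i := t)) \<partial>\<mu> i)"
    unfolding coordinate_lipschitz_def by auto
  show "(\<lambda>x. \<integral>t. (F (x(i := t)))\<^sup>2 \<partial>\<mu> i) \<in> borel_measurable (Pi\<^sub>M I (\<lambda>_. borel))"
    by measurable
qed

text \<open>This is the Efron--Stein inequality in the Lipschitz case. Conditionally on the other
  coordinates, the variance in coordinate \<open>i\<close> is at most the mean squared distance to the value at
  \<open>0\<close>, hence at most \<open>c\<^sub>i\<^sup>2 E[t\<^sup>2]\<close>; the conditional mean is again Lipschitz with the same constants,
  so the law of total variance allows induction.\<close>
lemma variance_coordinate_lipschitz:
  assumes "finite I" "coordinate_lipschitz I c F" "\<And>i. i \<in> I \<Longrightarrow> 0 \<le> c i"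
  shows "(\<integral>x. (F x)\<^sup>2 \<partial>Pi\<^sub>M I \<mu>) - (\<integral>x. F x \<partial>Pi\<^sub>M I \<mu>)\<^sup>2 \<le> (\<Sum>i\<in>I. (c i)\<^sup>2 * (\<integral>t. t\<^sup>2 \<partial>\<mu> i))"
  using assms
proof (induction I arbitrary: F rule: finite_induct)
  case empty
  then show ?case by (simp add: PiM_empty lebesgue_integral_count_space_finite)
next
  case (insert i I)
  interpret P: prob_space "\<mu> i" by (rule prob_law)
  interpret PI: prob_space "Pi\<^sub>M I \<mu>" by (rule prob_space_PiM) (rule prob_law)
  define G where "G x = (\<integral>t. F (x(i := t)) \<partial>\<mu> i)" for x
  note [measurable_cong] = sets_PiM_laws
  define H where "H x = (\<integral>t. (F (x(i := t)))\<^sup>2 \<partial>\<mu> i)" for x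
  define v where "v = (c i)\<^sup>2 * (\<integral>t. t\<^sup>2 \<partial>\<mu> i)"
  have ci: "0 \<le> c i" and cI: "\<And>j. j \<in> I \<Longrightarrow> 0 \<le> c j" using insert.prems by auto
  note L = coordinate_lipschitz_integral[OF insert.prems(1) insert.hyps ci]
  have G: "coordinate_lipschitz I c G" unfolding G_def by (rule L)
  have H[measurable]: "H \<in> borel_measurable (Pi\<^sub>M I (\<lambda>_. borel))" unfolding H_def by (rule L)
  note F_int = integrable_coordinate_lipschitz[OF insert.prems(1) finite.insertI[OF insert.hyps(1)] insert.prems(2)]
  note F_sq = integrable_coordinate_lipschitz_square[OF insert.prems(1) finite.insertI[OF insert.hyps(1)] insert.prems(2)]
  note G_sq = integrable_coordinate_lipschitz_square[OF G insert.hyps(1) cI]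
  have H_le: "H x \<le> (G x)\<^sup>2 + v" for x
  proof -
    have "H x - (G x)\<^sup>2 = (\<integral>t. (F (x(i := t)) - G x)\<^sup>2 \<partial>\<mu> i)"
      unfolding H_def G_def by (rule P.variance_eq[OF L(1,2), symmetric])
    \<comment> \<open>Replacing the mean \<open>G x\<close> by any other centre, here the value at \<open>0\<close>, increases the mean square.\<close>
    also have "\<dots> \<le> (\<integral>t. (F (x(i := t)) - G x)\<^sup>2 \<partial>\<mu> i) + (G x - F (x(i := 0)))\<^sup>2"
      by simp
    also have "\<dots> = (\<integral>t. (F (x(i := t)) - F (x(i := 0)))\<^sup>2 \<partial>\<mu> i)"
    proof -
      define \<phi> where "\<phi> t = F (x(i := t))" for t
      have \<phi>: "integrable (\<mu> i) \<phi>" "integrable (\<mu> i) (\<lambda>t. (\<phi> t)\<^sup>2)"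
        unfolding \<phi>_def by (rule L)+
      have "(\<integral>t. (\<phi> t - a)\<^sup>2 \<partial>\<mu> i) = (\<integral>t. (\<phi> t)\<^sup>2 \<partial>\<mu> i) - 2 * a * (\<integral>t. \<phi> t \<partial>\<mu> i) + a\<^sup>2" for a
      proof -
        have "(\<integral>t. (\<phi> t - a)\<^sup>2 \<partial>\<mu> i) = (\<integral>t. (\<phi> t)\<^sup>2 - 2 * a * \<phi> t + a\<^sup>2 \<partial>\<mu> i)"
          by (rule Bochner_Integration.integral_cong) (simp_all add: power2_diff)
        then show ?thesis using \<phi> by (simp add: P.prob_space)
      qed
      then have E: "(\<integral>t. (F (x(i := t)) - a)\<^sup>2 \<partial>\<mu> i) = H x - 2 * a * G x + a\<^sup>2" for a
        unfolding H_def G_def \<phi>_def .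
      show ?thesis unfolding E by (simp add: power2_eq_square algebra_simps)
    qed
    also have "\<dots> \<le> (\<integral>t. (c i)\<^sup>2 * t\<^sup>2 \<partial>\<mu> i)"
    proof (rule integral_mono)
      show "integrable (\<mu> i) (\<lambda>t. (F (x(i := t)) - F (x(i := 0)))\<^sup>2)"
        unfolding power2_diff
        by (intro Bochner_Integration.integrable_add Bochner_Integration.integrable_diff
            integrable_mult_left integrable_mult_right L(1,2) P.integrable_const)
      show "integrable (\<mu> i) (\<lambda>t. (c i)\<^sup>2 * t\<^sup>2)" by (simp add: square_integrable_law)
      show "(F (x(i := t)) - F (x(i := 0)))\<^sup>2 \<le> (c i)\<^sup>2 * t\<^sup>2" for t
      proof -
        have "\<bar>F (x(i := t)) - F (x(i := 0))\<bar> \<le> c i * \<bar>t - 0\<bar>"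
          by (rule coordinate_lipschitz_update[OF insert.prems(1) insert.hyps])
        from power_mono[OF this, of 2] show ?thesis by (simp add: power_mult_distrib)
      qed
    qed
    finally show ?thesis by (simp add: v_def)
  qed
  have H_nonneg: "0 \<le> H x" for x unfolding H_def by simp
  have "(\<integral>x. (F x)\<^sup>2 \<partial>Pi\<^sub>M (insert i I) \<mu>) = (\<integral>x. H x \<partial>Pi\<^sub>M I \<mu>)"
    unfolding H_def by (rule product_integral_insert[OF insert.hyps F_sq])
  also have "\<dots> \<le> (\<integral>x. (G x)\<^sup>2 + v \<partial>Pi\<^sub>M I \<mu>)"
  proof (rule integral_mono)
    show gi: "integrable (Pi\<^sub>M I \<mu>) (\<lambda>x. (G x)\<^sup>2 + v)" using G_sq by simp
    show "integrable (Pi\<^sub>M I \<mu>) H"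
      by (rule Bochner_Integration.integrable_bound[OF gi]) 
         (use H_le H_nonneg in \<open>auto intro!: AE_I2 order_trans[OF _ abs_ge_self]\<close>)
  qed (rule H_le)
  also have "\<dots> = (\<integral>x. (G x)\<^sup>2 \<partial>Pi\<^sub>M I \<mu>) + v" using G_sq by (simp add: PI.prob_space)
  finally have 1: "(\<integral>x. (F x)\<^sup>2 \<partial>Pi\<^sub>M (insert i I) \<mu>) \<le> (\<integral>x. (G x)\<^sup>2 \<partial>Pi\<^sub>M I \<mu>) + v" .
  have 2: "(\<integral>x. F x \<partial>Pi\<^sub>M (insert i I) \<mu>) = (\<integral>x. G x \<partial>Pi\<^sub>M I \<mu>)"
    unfolding G_def by (rule product_integral_insert[OF insert.hyps F_int])
  have 3: "(\<integral>x. (G x)\<^sup>2 \<partial>Pi\<^sub>M I \<mu>) - (\<integral>x. G x \<partial>Pi\<^sub>M I \<mu>)\<^sup>2 \<le> (\<Sum>j\<in>I. (c j)\<^sup>2 * (\<integral>t. t\<^sup>2 \<partial>\<mu> j))"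
    by (rule insert.IH[OF G cI])
  show ?case using 1 2 3 insert.hyps by (simp add: v_def)
qed

end

lemma square_integrable_laws_if:
  assumes "square_integrable_laws \<mu>" "square_integrable_laws \<nu>"
  shows "square_integrable_laws (\<lambda>i. if i \<in> K then \<nu> i else \<mu> i)"
  using assms by (auto simp: square_integrable_laws_def)

text \<open>Lindeberg's telescoping. The hybrid family \<open>\<eta> K\<close> has the new laws on \<open>K\<close> and the old ones
  elsewhere. Enlarging \<open>K\<close> by one index changes one factor of the product, and by Fubini the
  change of the integral is an average of one-coordinate differences.\<close>
lemma lindeberg_replacement:
  assumes \<mu>: "square_integrable_laws \<mu>" and \<nu>: "square_integrable_laws \<nu>"
    and fin: "finite I" and F: "coordinate_lipschitz I c F" and c: "\<And>i. i \<in> I \<Longrightarrow> 0 \<le> c i"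
    and one: "\<And>i x. i \<in> I \<Longrightarrow> \<bar>(\<integral>t. F (x(i := t)) \<partial>\<mu> i) - (\<integral>t. F (x(i := t)) \<partial>\<nu> i)\<bar> \<le> \<delta> i"
  shows "\<bar>(\<integral>x. F x \<partial>Pi\<^sub>M I \<mu>) - (\<integral>x. F x \<partial>Pi\<^sub>M I \<nu>)\<bar> \<le> (\<Sum>i\<in>I. \<delta> i)"
proof -
  define \<eta> where "\<eta> K i = (if i \<in> K then \<nu> i else \<mu> i)" for K i
  have "\<bar>(\<integral>x. F x \<partial>Pi\<^sub>M I \<mu>) - (\<integral>x. F x \<partial>Pi\<^sub>M I (\<eta> K))\<bar> \<le> (\<Sum>i\<in>K. \<delta> i)" if "finite K" "K \<subseteq> I" for K
    using that
  proof (induction K rule: finite_induct)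
    case empty
    then show ?case by (simp add: \<eta>_def)
  next
    case (insert i K)
    then have i: "i \<in> I" "i \<notin> K" by auto
    define I' where "I' = I - {i}"
    have I: "I = insert i I'" and I': "finite I'" "i \<notin> I'"
      using i fin by (auto simp: I'_def)
    have laws: "square_integrable_laws (\<eta> K')" for K'
      unfolding \<eta>_def by (rule square_integrable_laws_if[OF \<mu> \<nu>])
    interpret A: square_integrable_laws "\<eta> K" by (rule laws)
    interpret B: square_integrable_laws "\<eta> (insert i K)" by (rule laws)
    interpret PI: prob_space "Pi\<^sub>M I' (\<eta> K)" by (rule prob_space_PiM) (rule A.prob_law)
    have F': "coordinate_lipschitz (insert i I') c F" using F I by simp
    have c': "\<And>j. j \<in> I' \<Longrightarrow> 0 \<le> c j" "0 \<le> c i" using c I by auto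
    have eq: "Pi\<^sub>M I' (\<eta> (insert i K)) = Pi\<^sub>M I' (\<eta> K)"
      by (rule PiM_cong) (auto simp: \<eta>_def I'_def)
    note LA = A.coordinate_lipschitz_integral[OF F' I' c'(2)]
    note LB = B.coordinate_lipschitz_integral[OF F' I' c'(2)]
    have intA: "integrable (Pi\<^sub>M I' (\<eta> K)) (\<lambda>x. \<integral>t. F (x(i := t)) \<partial>\<mu> i)"
      using A.integrable_coordinate_lipschitz[OF LA(3) I'(1) c'(1)] i by (simp add: \<eta>_def)
    have intB: "integrable (Pi\<^sub>M I' (\<eta> K)) (\<lambda>x. \<integral>t. F (x(i := t)) \<partial>\<nu> i)"
      using A.integrable_coordinate_lipschitz[OF LB(3) I'(1) c'(1)] i by (simp add: \<eta>_def)
    have "(\<integral>x. F x \<partial>Pi\<^sub>M I (\<eta> K)) = (\<integral>x. (\<integral>t. F (x(i := t)) \<partial>\<mu> i) \<partial>Pi\<^sub>M I' (\<eta> K))"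
      using A.product_integral_insert[OF I' A.integrable_coordinate_lipschitz[OF F']] fin c i
      by (auto simp: I[symmetric] \<eta>_def)
    moreover have "(\<integral>x. F x \<partial>Pi\<^sub>M I (\<eta> (insert i K))) = (\<integral>x. (\<integral>t. F (x(i := t)) \<partial>\<nu> i) \<partial>Pi\<^sub>M I' (\<eta> K))"
      using B.product_integral_insert[OF I' B.integrable_coordinate_lipschitz[OF F']] fin c i
      unfolding eq by (auto simp: I[symmetric] \<eta>_def)
    ultimately have "\<bar>(\<integral>x. F x \<partial>Pi\<^sub>M I (\<eta> K)) - (\<integral>x. F x \<partial>Pi\<^sub>M I (\<eta> (insert i K)))\<bar>
        = \<bar>\<integral>x. (\<integral>t. F (x(i := t)) \<partial>\<mu> i) - (\<integral>t. F (x(i := t)) \<partial>\<nu> i) \<partial>Pi\<^sub>M I' (\<eta> K)\<bar>"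
      using intA intB by simp
    also have "\<dots> \<le> (\<integral>x. \<bar>(\<integral>t. F (x(i := t)) \<partial>\<mu> i) - (\<integral>t. F (x(i := t)) \<partial>\<nu> i)\<bar> \<partial>Pi\<^sub>M I' (\<eta> K))"
      by (rule integral_abs_bound)
    also have "\<dots> \<le> (\<integral>x. \<delta> i \<partial>Pi\<^sub>M I' (\<eta> K))"
      by (intro integral_mono integrable_abs Bochner_Integration.integrable_diff intA intB PI.integrable_const one i)
    also have "\<dots> = \<delta> i" by (simp add: PI.prob_space)
    finally show ?case using insert by auto
  qed
  from this[OF fin order_refl] have "\<bar>(\<integral>x. F x \<partial>Pi\<^sub>M I \<mu>) - (\<integral>x. F x \<partial>Pi\<^sub>M I (\<eta> I))\<bar> \<le> (\<Sum>i\<in>I. \<delta> i)" .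
  moreover have "Pi\<^sub>M I (\<eta> I) = Pi\<^sub>M I \<nu>" by (rule PiM_cong) (auto simp: \<eta>_def)
  ultimately show ?thesis by simp
qed

section \<open>The free energy as a function of one coupling\<close>

text \<open>The \<open>k\<close>-th moment of \<open>c\<close> under the Gibbs measure with weights proportional to
  \<open>w \<sigma> exp (c \<sigma> t)\<close>.\<close>
definition gibbs_moment :: "'s set \<Rightarrow> ('s \<Rightarrow> real) \<Rightarrow> ('s \<Rightarrow> real) \<Rightarrow> nat \<Rightarrow> real \<Rightarrow> real" where
  "gibbs_moment S w c k t = (\<Sum>\<sigma>\<in>S. w \<sigma> * c \<sigma> ^ k * exp (c \<sigma> * t)) / (\<Sum>\<sigma>\<in>S. w \<sigma> * exp (c \<sigma> * t))"

context
  fixes S :: "'s set" and w c :: "'s \<Rightarrow> real" and b :: real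
  assumes S: "finite S" "S \<noteq> {}" and w: "\<And>\<sigma>. \<sigma> \<in> S \<Longrightarrow> 0 < w \<sigma>"
    and c: "\<And>\<sigma>. \<sigma> \<in> S \<Longrightarrow> \<bar>c \<sigma>\<bar> \<le> b"
begin

lemma partition_function_pos: "0 < (\<Sum>\<sigma>\<in>S. w \<sigma> * exp (c \<sigma> * t))"
  by (rule sum_pos) (use S w in auto)

lemma gibbs_moment_bound: "\<bar>gibbs_moment S w c k t\<bar> \<le> b ^ k"
proof -
  have "\<bar>\<Sum>\<sigma>\<in>S. w \<sigma> * c \<sigma> ^ k * exp (c \<sigma> * t)\<bar> \<le> (\<Sum>\<sigma>\<in>S. \<bar>w \<sigma> * c \<sigma> ^ k * exp (c \<sigma> * t)\<bar>)"
    by (rule sum_abs)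
  also have "\<dots> \<le> (\<Sum>\<sigma>\<in>S. b ^ k * (w \<sigma> * exp (c \<sigma> * t)))"
  proof (rule sum_mono)
    fix \<sigma> assume \<sigma>: "\<sigma> \<in> S"
    have "\<bar>c \<sigma>\<bar> ^ k \<le> b ^ k" by (rule power_mono) (use c[OF \<sigma>] in auto)
    then have "\<bar>c \<sigma>\<bar> ^ k * (w \<sigma> * exp (c \<sigma> * t)) \<le> b ^ k * (w \<sigma> * exp (c \<sigma> * t))"
      by (rule mult_right_mono) (use w[OF \<sigma>] in auto)
    then show "\<bar>w \<sigma> * c \<sigma> ^ k * exp (c \<sigma> * t)\<bar> \<le> b ^ k * (w \<sigma> * exp (c \<sigma> * t))"
      using w[OF \<sigma>] by (simp add: abs_mult power_abs mult_ac)
  qed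
  also have "\<dots> = b ^ k * (\<Sum>\<sigma>\<in>S. w \<sigma> * exp (c \<sigma> * t))" by (simp add: sum_distrib_left)
  finally show ?thesis using partition_function_pos[of t]
    by (simp add: gibbs_moment_def field_simps)
qed

lemma has_derivative_log_partition:
  "((\<lambda>t. ln (\<Sum>\<sigma>\<in>S. w \<sigma> * exp (c \<sigma> * t))) has_real_derivative gibbs_moment S w c 1 t) (at t)"
proof -
  have "((\<lambda>t. (\<Sum>\<sigma>\<in>S. w \<sigma> * exp (c \<sigma> * t))) has_real_derivative
      (\<Sum>\<sigma>\<in>S. w \<sigma> * c \<sigma> ^ 1 * exp (c \<sigma> * t))) (at t)"
    by (rule DERIV_sum) (auto intro!: derivative_eq_intros)
  from DERIV_chain2[OF DERIV_ln_divide[OF partition_function_pos] this]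
  show ?thesis by (simp add: gibbs_moment_def)
qed

lemma has_derivative_gibbs_moment:
  "(gibbs_moment S w c k has_real_derivative
    gibbs_moment S w c (Suc k) t - gibbs_moment S w c k t * gibbs_moment S w c 1 t) (at t)"
proof -
  let ?N = "\<lambda>k t. \<Sum>\<sigma>\<in>S. w \<sigma> * c \<sigma> ^ k * exp (c \<sigma> * t)"
  let ?D = "\<lambda>t. \<Sum>\<sigma>\<in>S. w \<sigma> * exp (c \<sigma> * t)"
  have N: "(?N k has_real_derivative ?N (Suc k) t) (at t)" for k
    by (rule DERIV_sum) (auto intro!: derivative_eq_intros)
  have D: "(?D has_real_derivative ?N 1 t) (at t)"
    using N[of 0] by simp
  have "((\<lambda>t. ?N k t / ?D t) has_real_derivative
      (?N (Suc k) t * ?D t - ?N k t * ?N 1 t) / (?D t * ?D t)) (at t)"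
    by (rule DERIV_divide[OF N D]) (use partition_function_pos[of t] in linarith)
  moreover have "(?N (Suc k) t * ?D t - ?N k t * ?N 1 t) / (?D t * ?D t)
      = gibbs_moment S w c (Suc k) t - gibbs_moment S w c k t * gibbs_moment S w c 1 t"
    unfolding gibbs_moment_def using partition_function_pos[of t] by (simp add: field_simps)
  ultimately show ?thesis unfolding gibbs_moment_def by simp
qed

text \<open>The derivatives of the log partition function are the cumulants of \<open>c\<close> under the Gibbs
  measure, computed from the rule \<open>m\<^sub>k' = m\<^sub>k\<^sub>+\<^sub>1 - m\<^sub>k m\<^sub>1\<close> for its moments. Since \<open>|c| \<le> b\<close>, the second
  one is at most \<open>2 b\<^sup>2\<close> and the third at most \<open>6 b\<^sup>3\<close>, uniformly in \<open>t\<close>; the factorials of Taylor's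
  formula cancel the constants.\<close>
lemma log_partition_taylor:
  obtains a0 a1 a2 where "\<bar>a2\<bar> \<le> b\<^sup>2"
    "\<And>t. \<bar>ln (\<Sum>\<sigma>\<in>S. w \<sigma> * exp (c \<sigma> * t)) - (a0 + a1 * t + a2 * t\<^sup>2)\<bar> \<le> b ^ 3 * \<bar>t\<bar> ^ 3"
proof -
  define m where "m = gibbs_moment S w c"
  define L where "L t = ln (\<Sum>\<sigma>\<in>S. w \<sigma> * exp (c \<sigma> * t))" for t
  define d2 where "d2 t = m 2 t - m 1 t * m 1 t" for t
  define d3 where "d3 t = m 3 t - 3 * (m 1 t * m 2 t) + 2 * m 1 t ^ 3" for t
  define diff where "diff k = (if k = 0 then L else if k = 1 then m 1 else if k = 2 then d2 else d3)" for k :: nat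
  have b: "0 \<le> b" using S c by fastforce
  have "(d2 has_real_derivative d3 t) (at t)" for t
    unfolding d2_def[abs_def] d3_def m_def
    by (rule derivative_eq_intros has_derivative_gibbs_moment refl)+
       (simp add: algebra_simps eval_nat_numeral)
  moreover have "(m 1 has_real_derivative d2 t) (at t)" for t
    using has_derivative_gibbs_moment[of 1 t] by (simp add: d2_def m_def eval_nat_numeral)
  moreover have "(L has_real_derivative m 1 t) (at t)" for t
    unfolding L_def[abs_def] m_def by (rule has_derivative_log_partition)
  ultimately have diff: "k < 3 \<Longrightarrow> (diff k has_real_derivative diff (Suc k) t) (at t)" for k t
    by (auto simp: diff_def less_Suc_eq eval_nat_numeral)
  have m: "\<bar>m k t\<bar> \<le> b ^ k" for k t unfolding m_def by (rule gibbs_moment_bound)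
  have m11: "\<bar>m 1 t * m 1 t\<bar> \<le> b\<^sup>2" for t
    unfolding abs_mult power2_eq_square using m[of 1 t] b by (intro mult_mono) auto
  have "\<bar>d2 0\<bar> \<le> 2 * b\<^sup>2"
    unfolding d2_def using m[of 2 0] m11[of 0] by linarith
  then have a2: "\<bar>d2 0 / 2\<bar> \<le> b\<^sup>2" by simp
  have d3: "\<bar>d3 t\<bar> \<le> 6 * b ^ 3" for t
  proof -
    have "\<bar>m 1 t * m 2 t\<bar> \<le> b ^ 1 * b ^ 2"
      unfolding abs_mult using m[of 1 t] m[of 2 t] b by (intro mult_mono) auto
    moreover have "\<bar>m 1 t ^ 3\<bar> \<le> b ^ 3"
      unfolding power_abs using m[of 1 t] by (intro power_mono) auto
    moreover have "b ^ 1 * b ^ 2 = b ^ 3" by (simp add: eval_nat_numeral)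
    ultimately show ?thesis unfolding d3_def using m[of 3 t] by linarith
  qed
  have "\<bar>L t - (L 0 + m 1 0 * t + d2 0 / 2 * t\<^sup>2)\<bar> \<le> b ^ 3 * \<bar>t\<bar> ^ 3" for t
  proof -
    obtain s where "L t = (\<Sum>k<3. diff k 0 / fact k * t ^ k) + diff 3 s / fact 3 * t ^ 3"
      using Maclaurin_bi_le[of diff L 3 t] diff by (auto simp: diff_def)
    then have "L t - (L 0 + m 1 0 * t + d2 0 / 2 * t\<^sup>2) = d3 s / 6 * t ^ 3"
      by (simp add: diff_def eval_nat_numeral)
    moreover have "\<bar>d3 s / 6 * t ^ 3\<bar> \<le> b ^ 3 * \<bar>t\<bar> ^ 3"
      unfolding abs_mult power_abs using d3[of s] by (intro mult_right_mono) auto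
    ultimately show ?thesis by simp
  qed
  with a2 show thesis using that unfolding L_def by blast
qed

end

text \<open>The sum is at least its largest term and at most \<open>card S\<close> times it.\<close>
lemma max_le_log_partition:
  fixes h :: "'s \<Rightarrow> real"
  assumes S: "finite S" "S \<noteq> {}" and \<beta>: "0 < \<beta>"
  shows "(MAX \<sigma>\<in>S. h \<sigma>) \<le> ln (\<Sum>\<sigma>\<in>S. exp (\<beta> * h \<sigma>)) / \<beta>"
    and "ln (\<Sum>\<sigma>\<in>S. exp (\<beta> * h \<sigma>)) / \<beta> \<le> (MAX \<sigma>\<in>S. h \<sigma>) + ln (card S) / \<beta>"
proof -
  have pos: "0 < (\<Sum>\<sigma>\<in>S. exp (\<beta> * h \<sigma>))" by (rule sum_pos) (use S in auto)
  have "(MAX \<sigma>\<in>S. h \<sigma>) \<in> h ` S" by (rule Max_in) (use S in auto)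
  then obtain \<tau> where \<tau>: "(MAX \<sigma>\<in>S. h \<sigma>) = h \<tau>" "\<tau> \<in> S" by (rule imageE)
  have "exp (\<beta> * h \<tau>) \<le> (\<Sum>\<sigma>\<in>S. exp (\<beta> * h \<sigma>))"
    by (rule member_le_sum) (use S \<tau> in auto)
  then have "\<beta> * h \<tau> \<le> ln (\<Sum>\<sigma>\<in>S. exp (\<beta> * h \<sigma>))" using pos by (simp add: ln_ge_iff)
  then show "(MAX \<sigma>\<in>S. h \<sigma>) \<le> ln (\<Sum>\<sigma>\<in>S. exp (\<beta> * h \<sigma>)) / \<beta>"
    using \<beta> \<tau> by (simp add: field_simps)
  have "h \<sigma> \<le> h \<tau>" if "\<sigma> \<in> S" for \<sigma>
    using that S unfolding \<tau>(1)[symmetric] by (intro Max_ge) auto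
  then have "(\<Sum>\<sigma>\<in>S. exp (\<beta> * h \<sigma>)) \<le> (\<Sum>\<sigma>\<in>S. exp (\<beta> * h \<tau>))"
    using \<beta> by (intro sum_mono) auto
  then have "ln (\<Sum>\<sigma>\<in>S. exp (\<beta> * h \<sigma>)) \<le> ln (card S * exp (\<beta> * h \<tau>))"
    using pos by simp
  also have "\<dots> = ln (card S) + \<beta> * h \<tau>"
    using S by (subst ln_mult) (auto simp: card_gt_0_iff)
  finally show "ln (\<Sum>\<sigma>\<in>S. exp (\<beta> * h \<sigma>)) / \<beta> \<le> (MAX \<sigma>\<in>S. h \<sigma>) + ln (card S) / \<beta>"
    using \<beta> \<tau> by (simp add: field_simps)
qed

section \<open>Universality of maxima of linear forms\<close>

definition max_linear :: "'s set \<Rightarrow> 'i set \<Rightarrow> ('s \<Rightarrow> 'i \<Rightarrow> real) \<Rightarrow> ('i \<Rightarrow> real) \<Rightarrow> real" where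
  "max_linear S I a x = (MAX \<sigma>\<in>S. \<Sum>i\<in>I. a \<sigma> i * x i)"

definition free_energy :: "real \<Rightarrow> 's set \<Rightarrow> 'i set \<Rightarrow> ('s \<Rightarrow> 'i \<Rightarrow> real) \<Rightarrow> ('i \<Rightarrow> real) \<Rightarrow> real" where
  "free_energy \<beta> S I a x = ln (\<Sum>\<sigma>\<in>S. exp (\<beta> * (\<Sum>i\<in>I. a \<sigma> i * x i))) / \<beta>"

context
  fixes S :: "'s set" and I :: "'i set" and a :: "'s \<Rightarrow> 'i \<Rightarrow> real" and b :: real
  assumes S: "finite S" "S \<noteq> {}" and I: "finite I"
    and a: "\<And>\<sigma> i. \<sigma> \<in> S \<Longrightarrow> i \<in> I \<Longrightarrow> \<bar>a \<sigma> i\<bar> \<le> b"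
begin

lemma linear_form_lipschitz:
  assumes "\<sigma> \<in> S"
  shows "(\<Sum>i\<in>I. a \<sigma> i * x i) \<le> (\<Sum>i\<in>I. a \<sigma> i * y i) + (\<Sum>i\<in>I. b * \<bar>x i - y i\<bar>)"
  unfolding sum.distrib[symmetric]
proof (rule sum_mono)
  fix i assume "i \<in> I"
  have "a \<sigma> i * (x i - y i) \<le> \<bar>a \<sigma> i\<bar> * \<bar>x i - y i\<bar>" by (metis abs_ge_self abs_mult)
  also have "\<dots> \<le> b * \<bar>x i - y i\<bar>"
    by (rule mult_right_mono) (use a[OF assms \<open>i \<in> I\<close>] in auto)
  finally show "a \<sigma> i * x i \<le> a \<sigma> i * y i + b * \<bar>x i - y i\<bar>" by (simp add: algebra_simps)
qed

lemma max_linear_lipschitz: "coordinate_lipschitz I (\<lambda>_. b) (max_linear S I a)"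
proof -
  have "max_linear S I a x \<le> max_linear S I a y + (\<Sum>i\<in>I. b * \<bar>x i - y i\<bar>)" for x y
  proof -
    have "(\<Sum>i\<in>I. a \<sigma> i * x i) \<le> max_linear S I a y + (\<Sum>i\<in>I. b * \<bar>x i - y i\<bar>)" if "\<sigma> \<in> S" for \<sigma>
    proof -
      have "(\<Sum>i\<in>I. a \<sigma> i * y i) \<le> max_linear S I a y"
        unfolding max_linear_def using S that by (intro Max_ge) auto
      then show ?thesis using linear_form_lipschitz[OF that, of x y] by linarith
    qed
    then show ?thesis unfolding max_linear_def[of S I a x] using S by (subst Max_le_iff) auto
  qed
  from this this have "\<bar>max_linear S I a x - max_linear S I a y\<bar> \<le> (\<Sum>i\<in>I. b * \<bar>x i - y i\<bar>)" for x y
    using abs_minus_commute by (smt (verit) sum.cong)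
  moreover have "max_linear S I a \<in> borel_measurable (Pi\<^sub>M I (\<lambda>_. borel))"
    unfolding max_linear_def[abs_def] by (rule borel_measurable_Max) (use S in auto)
  ultimately show ?thesis unfolding coordinate_lipschitz_def by blast
qed

lemma free_energy_lipschitz:
  assumes \<beta>: "0 < \<beta>"
  shows "coordinate_lipschitz I (\<lambda>_. b) (free_energy \<beta> S I a)"
proof -
  have pos: "0 < (\<Sum>\<sigma>\<in>S. exp (\<beta> * (\<Sum>i\<in>I. a \<sigma> i * x i)))" for x
    by (rule sum_pos) (use S in auto)
  have "free_energy \<beta> S I a x \<le> free_energy \<beta> S I a y + (\<Sum>i\<in>I. b * \<bar>x i - y i\<bar>)" for x y
  proof -
    define D where "D = (\<Sum>i\<in>I. b * \<bar>x i - y i\<bar>)"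
    have "(\<Sum>\<sigma>\<in>S. exp (\<beta> * (\<Sum>i\<in>I. a \<sigma> i * x i)))
        \<le> (\<Sum>\<sigma>\<in>S. exp (\<beta> * D) * exp (\<beta> * (\<Sum>i\<in>I. a \<sigma> i * y i)))"
    proof (rule sum_mono)
      fix \<sigma> assume "\<sigma> \<in> S"
      have "\<beta> * (\<Sum>i\<in>I. a \<sigma> i * x i) \<le> \<beta> * (D + (\<Sum>i\<in>I. a \<sigma> i * y i))"
        using linear_form_lipschitz[OF \<open>\<sigma> \<in> S\<close>, of x y] \<beta> by (intro mult_left_mono) (auto simp: D_def)
      then show "exp (\<beta> * (\<Sum>i\<in>I. a \<sigma> i * x i)) \<le> exp (\<beta> * D) * exp (\<beta> * (\<Sum>i\<in>I. a \<sigma> i * y i))"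
        unfolding exp_add[symmetric] exp_le_cancel_iff by (simp add: distrib_left)
    qed
    also have "\<dots> = exp (\<beta> * D) * (\<Sum>\<sigma>\<in>S. exp (\<beta> * (\<Sum>i\<in>I. a \<sigma> i * y i)))"
      by (simp add: sum_distrib_left)
    finally have "ln (\<Sum>\<sigma>\<in>S. exp (\<beta> * (\<Sum>i\<in>I. a \<sigma> i * x i)))
        \<le> ln (exp (\<beta> * D) * (\<Sum>\<sigma>\<in>S. exp (\<beta> * (\<Sum>i\<in>I. a \<sigma> i * y i))))"
      using pos[of x] pos[of y] by simp
    also have "\<dots> = \<beta> * D + ln (\<Sum>\<sigma>\<in>S. exp (\<beta> * (\<Sum>i\<in>I. a \<sigma> i * y i)))"
      using pos[of y] by (simp add: ln_mult_pos)
    finally show ?thesis unfolding free_energy_def D_def[symmetric] using \<beta> by (simp add: field_simps)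
  qed
  from this this have "\<bar>free_energy \<beta> S I a x - free_energy \<beta> S I a y\<bar> \<le> (\<Sum>i\<in>I. b * \<bar>x i - y i\<bar>)" for x y
    using abs_minus_commute by (smt (verit) sum.cong)
  moreover have "free_energy \<beta> S I a \<in> borel_measurable (Pi\<^sub>M I (\<lambda>_. borel))"
    unfolding free_energy_def[abs_def] by measurable
  ultimately show ?thesis unfolding coordinate_lipschitz_def by blast
qed

text \<open>The remaining coordinates only enter through the weights of the Gibbs measure, so the bounds
  do not depend on them.\<close>
lemma free_energy_taylor:
  assumes \<beta>: "0 < \<beta>" and i: "i \<in> I"
  obtains a0 a1 a2 where "\<bar>a2\<bar> \<le> \<beta> * b\<^sup>2"
    "\<And>t. \<bar>free_energy \<beta> S I a (x(i := t)) - (a0 + a1 * t + a2 * t\<^sup>2)\<bar> \<le> \<beta>\<^sup>2 * b ^ 3 * \<bar>t\<bar> ^ 3"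
proof -
  define w where "w \<sigma> = exp (\<beta> * (\<Sum>j\<in>I-{i}. a \<sigma> j * x j))" for \<sigma>
  have split: "exp (\<beta> * (\<Sum>j\<in>I. a \<sigma> j * (x(i := t)) j)) = w \<sigma> * exp (\<beta> * a \<sigma> i * t)" for \<sigma> t
  proof -
    have "(\<Sum>j\<in>I. a \<sigma> j * (x(i := t)) j) = a \<sigma> i * t + (\<Sum>j\<in>I-{i}. a \<sigma> j * x j)"
      using i I by (simp add: sum.remove)
    then show ?thesis by (simp add: w_def exp_add[symmetric] algebra_simps)
  qed
  have c: "\<bar>\<beta> * a \<sigma> i\<bar> \<le> \<beta> * b" if "\<sigma> \<in> S" for \<sigma>
    using a[OF that i] \<beta> by (simp add: abs_mult)
  have w: "0 < w \<sigma>" for \<sigma> by (simp add: w_def)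
  obtain a0 a1 a2 where a2: "\<bar>a2\<bar> \<le> (\<beta> * b)\<^sup>2" and
    t: "\<And>t. \<bar>ln (\<Sum>\<sigma>\<in>S. w \<sigma> * exp (\<beta> * a \<sigma> i * t)) - (a0 + a1 * t + a2 * t\<^sup>2)\<bar> \<le> (\<beta> * b) ^ 3 * \<bar>t\<bar> ^ 3"
    by (rule log_partition_taylor[where c = "\<lambda>\<sigma>. \<beta> * a \<sigma> i" and w = w, OF S w c]) (assumption, rule that)
  show thesis
  proof (rule that)
    show "\<bar>a2 / \<beta>\<bar> \<le> \<beta> * b\<^sup>2"
      using a2 \<beta> by (simp add: power2_eq_square field_simps)
    show "\<bar>free_energy \<beta> S I a (x(i := t)) - (a0 / \<beta> + a1 / \<beta> * t + a2 / \<beta> * t\<^sup>2)\<bar> \<le> \<beta>\<^sup>2 * b ^ 3 * \<bar>t\<bar> ^ 3" for t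
    proof -
      have "free_energy \<beta> S I a (x(i := t)) - (a0 / \<beta> + a1 / \<beta> * t + a2 / \<beta> * t\<^sup>2)
          = (ln (\<Sum>\<sigma>\<in>S. w \<sigma> * exp (\<beta> * a \<sigma> i * t)) - (a0 + a1 * t + a2 * t\<^sup>2)) / \<beta>"
        unfolding free_energy_def split by (simp add: diff_divide_distrib add_divide_distrib)
      also have "\<bar>\<dots>\<bar> \<le> (\<beta> * b) ^ 3 * \<bar>t\<bar> ^ 3 / \<beta>"
        using t[of t] \<beta> by (simp add: abs_divide divide_right_mono)
      also have "\<dots> = \<beta>\<^sup>2 * b ^ 3 * \<bar>t\<bar> ^ 3" using \<beta> by (simp add: eval_nat_numeral)
      finally show ?thesis .
    qed
  qed
qed

text \<open>The smoothing error \<open>ln (card S) / \<beta>\<close> enters once, since the free energy lies above the maximum.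
  In each replacement the constant and the linear Taylor term cancel, the quadratic one is
  controlled by the mismatch \<open>e2\<close> and the remainder by the third moments \<open>e3\<close>.\<close>
theorem max_linear_lindeberg:
  assumes \<mu>: "square_integrable_laws \<mu>" and \<nu>: "square_integrable_laws \<nu>" and \<beta>: "0 < \<beta>"
    and cube: "\<And>i. i \<in> I \<Longrightarrow> integrable (\<mu> i) (\<lambda>t. \<bar>t\<bar> ^ 3)" "\<And>i. i \<in> I \<Longrightarrow> integrable (\<nu> i) (\<lambda>t. \<bar>t\<bar> ^ 3)"
    and mean: "\<And>i. i \<in> I \<Longrightarrow> (\<integral>t. t \<partial>\<mu> i) = (\<integral>t. t \<partial>\<nu> i)"
    and second: "\<And>i. i \<in> I \<Longrightarrow> \<bar>(\<integral>t. t\<^sup>2 \<partial>\<mu> i) - (\<integral>t. t\<^sup>2 \<partial>\<nu> i)\<bar> \<le> e2"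
    and third: "\<And>i. i \<in> I \<Longrightarrow> (\<integral>t. \<bar>t\<bar> ^ 3 \<partial>\<mu> i) + (\<integral>t. \<bar>t\<bar> ^ 3 \<partial>\<nu> i) \<le> e3"
  shows "\<bar>(\<integral>x. max_linear S I a x \<partial>Pi\<^sub>M I \<mu>) - (\<integral>x. max_linear S I a x \<partial>Pi\<^sub>M I \<nu>)\<bar>
    \<le> ln (card S) / \<beta> + card I * (\<beta> * b\<^sup>2 * e2 + \<beta>\<^sup>2 * b ^ 3 * e3)"
proof -
  interpret A: square_integrable_laws \<mu> by (rule \<mu>)
  interpret B: square_integrable_laws \<nu> by (rule \<nu>)
  interpret PA: prob_space "Pi\<^sub>M I \<mu>" by (rule prob_space_PiM) (rule A.prob_law)
  interpret PB: prob_space "Pi\<^sub>M I \<nu>" by (rule prob_space_PiM) (rule B.prob_law)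
  have b: "0 \<le> b" if "i \<in> I" for i using S a that by fastforce
  note L = free_energy_lipschitz[OF \<beta>]
  have one: "\<bar>(\<integral>t. free_energy \<beta> S I a (x(i := t)) \<partial>\<mu> i) - (\<integral>t. free_energy \<beta> S I a (x(i := t)) \<partial>\<nu> i)\<bar>
      \<le> \<beta> * b\<^sup>2 * e2 + \<beta>\<^sup>2 * b ^ 3 * e3" if i: "i \<in> I" for i x
  proof -
    interpret Pi: prob_space "\<mu> i" by (rule A.prob_law)
    interpret Qi: prob_space "\<nu> i" by (rule B.prob_law)
    obtain a0 a1 a2 where a2: "\<bar>a2\<bar> \<le> \<beta> * b\<^sup>2" and
      t: "\<And>t. \<bar>free_energy \<beta> S I a (x(i := t)) - (a0 + a1 * t + a2 * t\<^sup>2)\<bar> \<le> \<beta>\<^sup>2 * b ^ 3 * \<bar>t\<bar> ^ 3"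
      by (rule free_energy_taylor[OF \<beta> i, of x]) (rule that)
    define R where "R t = free_energy \<beta> S I a (x(i := t)) - (a0 + a1 * t + a2 * t\<^sup>2)" for t
    have II: "insert i (I - {i}) = I" using i by auto
    have I': "finite (I - {i})" "i \<notin> I - {i}" using I by auto
    have L': "coordinate_lipschitz (insert i (I - {i})) (\<lambda>_. b) (free_energy \<beta> S I a)"
      unfolding II by (rule L)
    have *: "(\<integral>t. free_energy \<beta> S I a (x(i := t)) \<partial>\<eta>)
        = a0 + a1 * (\<integral>t. t \<partial>\<eta>) + a2 * (\<integral>t. t\<^sup>2 \<partial>\<eta>) + (\<integral>t. R t \<partial>\<eta>)
      \<and> \<bar>\<integral>t. R t \<partial>\<eta>\<bar> \<le> \<beta>\<^sup>2 * b ^ 3 * (\<integral>t. \<bar>t\<bar> ^ 3 \<partial>\<eta>)"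
      if \<eta>: "prob_space \<eta>" "integrable \<eta> (\<lambda>t. t)" "integrable \<eta> (\<lambda>t. t\<^sup>2)" "integrable \<eta> (\<lambda>t. \<bar>t\<bar> ^ 3)"
        "integrable \<eta> (\<lambda>t. free_energy \<beta> S I a (x(i := t)))" for \<eta> :: "real measure"
    proof -
      interpret E: prob_space \<eta> by (rule \<eta>)
      have R: "integrable \<eta> R" unfolding R_def[abs_def] using \<eta> by auto
      have "(\<integral>t. free_energy \<beta> S I a (x(i := t)) \<partial>\<eta>) = (\<integral>t. (a0 + a1 * t + a2 * t\<^sup>2) + R t \<partial>\<eta>)"
        by (simp add: R_def)
      also have "\<dots> = a0 + a1 * (\<integral>t. t \<partial>\<eta>) + a2 * (\<integral>t. t\<^sup>2 \<partial>\<eta>) + (\<integral>t. R t \<partial>\<eta>)"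
        using \<eta> R by (simp add: E.prob_space)
      finally have 1: "(\<integral>t. free_energy \<beta> S I a (x(i := t)) \<partial>\<eta>)
        = a0 + a1 * (\<integral>t. t \<partial>\<eta>) + a2 * (\<integral>t. t\<^sup>2 \<partial>\<eta>) + (\<integral>t. R t \<partial>\<eta>)" .
      have "\<bar>\<integral>t. R t \<partial>\<eta>\<bar> \<le> (\<integral>t. \<bar>R t\<bar> \<partial>\<eta>)" by (rule integral_abs_bound)
      also have "\<dots> \<le> (\<integral>t. \<beta>\<^sup>2 * b ^ 3 * \<bar>t\<bar> ^ 3 \<partial>\<eta>)"
        using R \<eta> t by (intro integral_mono) (auto simp: R_def)
      finally show ?thesis using 1 by simp
    qed
    note \<mu>i = *[OF A.prob_law A.integrable_law A.square_integrable_law cube(1)[OF i]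
        A.coordinate_lipschitz_integral(1)[OF L' I' b[OF i]]]
    note \<nu>i = *[OF B.prob_law B.integrable_law B.square_integrable_law cube(2)[OF i]
        B.coordinate_lipschitz_integral(1)[OF L' I' b[OF i]]]
    have e2: "\<bar>a2 * (\<integral>t. t\<^sup>2 \<partial>\<mu> i) - a2 * (\<integral>t. t\<^sup>2 \<partial>\<nu> i)\<bar> \<le> \<beta> * b\<^sup>2 * e2"
      unfolding right_diff_distrib[symmetric] abs_mult
      by (rule mult_mono) (use a2 second[OF i] \<beta> in auto)
    have "\<beta>\<^sup>2 * b ^ 3 * (\<integral>t. \<bar>t\<bar> ^ 3 \<partial>\<mu> i) + \<beta>\<^sup>2 * b ^ 3 * (\<integral>t. \<bar>t\<bar> ^ 3 \<partial>\<nu> i) \<le> \<beta>\<^sup>2 * b ^ 3 * e3"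
      unfolding distrib_left[symmetric] by (rule mult_left_mono) (use third[OF i] b[OF i] in auto)
    moreover note \<mu>i[THEN conjunct1] \<mu>i[THEN conjunct2] \<nu>i[THEN conjunct1] \<nu>i[THEN conjunct2]
    ultimately show ?thesis using e2 unfolding mean[OF i] by linarith
  qed
  have bb: "\<And>i. i \<in> I \<Longrightarrow> 0 \<le> (\<lambda>_. b) i" using b by simp
  have free: "\<bar>(\<integral>x. free_energy \<beta> S I a x \<partial>Pi\<^sub>M I \<mu>) - (\<integral>x. free_energy \<beta> S I a x \<partial>Pi\<^sub>M I \<nu>)\<bar>
      \<le> card I * (\<beta> * b\<^sup>2 * e2 + \<beta>\<^sup>2 * b ^ 3 * e3)"
    using lindeberg_replacement[OF \<mu> \<nu> I L bb one] by simp
  note int = A.integrable_coordinate_lipschitz[OF L I bb] B.integrable_coordinate_lipschitz[OF L I bb]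
    A.integrable_coordinate_lipschitz[OF max_linear_lipschitz I bb]
    B.integrable_coordinate_lipschitz[OF max_linear_lipschitz I bb]
  have m: "max_linear S I a x \<le> free_energy \<beta> S I a x"
     "free_energy \<beta> S I a x \<le> max_linear S I a x + ln (card S) / \<beta>" for x
    unfolding max_linear_def free_energy_def by (rule max_le_log_partition[OF S \<beta>])+
  have 1: "(\<integral>x. max_linear S I a x \<partial>Pi\<^sub>M I \<mu>) \<le> (\<integral>x. free_energy \<beta> S I a x \<partial>Pi\<^sub>M I \<mu>)"
    by (rule integral_mono[OF int(3) int(1) m(1)])
  have 4: "(\<integral>x. max_linear S I a x \<partial>Pi\<^sub>M I \<nu>) \<le> (\<integral>x. free_energy \<beta> S I a x \<partial>Pi\<^sub>M I \<nu>)"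
    by (rule integral_mono[OF int(4) int(2) m(1)])
  have "(\<integral>x. free_energy \<beta> S I a x \<partial>Pi\<^sub>M I \<mu>) \<le> (\<integral>x. max_linear S I a x + ln (card S) / \<beta> \<partial>Pi\<^sub>M I \<mu>)"
    by (intro integral_mono int m Bochner_Integration.integrable_add PA.integrable_const)
  then have 2: "(\<integral>x. free_energy \<beta> S I a x \<partial>Pi\<^sub>M I \<mu>) \<le> (\<integral>x. max_linear S I a x \<partial>Pi\<^sub>M I \<mu>) + ln (card S) / \<beta>"
    using int by (simp add: PA.prob_space)
  have "(\<integral>x. free_energy \<beta> S I a x \<partial>Pi\<^sub>M I \<nu>) \<le> (\<integral>x. max_linear S I a x + ln (card S) / \<beta> \<partial>Pi\<^sub>M I \<nu>)"
    by (intro integral_mono int m Bochner_Integration.integrable_add PB.integrable_const)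
  then have 3: "(\<integral>x. free_energy \<beta> S I a x \<partial>Pi\<^sub>M I \<nu>) \<le> (\<integral>x. max_linear S I a x \<partial>Pi\<^sub>M I \<nu>) + ln (card S) / \<beta>"
    using int by (simp add: PB.prob_space)
  show ?thesis using free 1 2 3 4 by linarith
qed

end

section \<open>Moments of the couplings\<close>

lemma integrable_return_borel:
  fixes g :: "real \<Rightarrow> real"
  assumes [measurable]: "g \<in> borel_measurable borel"
  shows "integrable (return borel x) g"
proof -
  interpret prob_space "return borel x" by (rule prob_space_return) simp
  have "integrable (return borel x) (\<lambda>_. g x)" by simp
  then show ?thesis
    by (rule integrable_cong_AE[THEN iffD1, rotated 3]) (auto simp: AE_return)
qed

lemma gaussian_moments:
  assumes "0 \<le> v"
  shows "integrable (gaussian 0 v) (\<lambda>t. t)" "(\<integral>t. t \<partial>gaussian 0 v) = 0"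
    and "integrable (gaussian 0 v) (\<lambda>t. t\<^sup>2)" "(\<integral>t. t\<^sup>2 \<partial>gaussian 0 v) = v"
    and "integrable (gaussian 0 v) (\<lambda>t. \<bar>t\<bar> ^ 3)" "(\<integral>t. \<bar>t\<bar> ^ 3 \<partial>gaussian 0 v) \<le> 2 * sqrt v ^ 3"
proof -
  consider "v = 0" | "0 < v" using assms by linarith
  then have "integrable (gaussian 0 v) (\<lambda>t. t) \<and> (\<integral>t. t \<partial>gaussian 0 v) = 0 \<and>
    integrable (gaussian 0 v) (\<lambda>t. t\<^sup>2) \<and> (\<integral>t. t\<^sup>2 \<partial>gaussian 0 v) = v \<and>
    integrable (gaussian 0 v) (\<lambda>t. \<bar>t\<bar> ^ 3) \<and> (\<integral>t. \<bar>t\<bar> ^ 3 \<partial>gaussian 0 v) \<le> 2 * sqrt v ^ 3"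
  proof cases
    case 1
    then show ?thesis by (simp add: gaussian_def integral_return integrable_return_borel)
  next
    case 2
    then have s: "0 < sqrt v" by simp
    have g: "gaussian 0 v = density lborel (\<lambda>x. ennreal (normal_density 0 (sqrt v) x))"
      using 2 by (simp add: gaussian_def)
    have *: "integrable (gaussian 0 v) h" "(\<integral>t. h t \<partial>gaussian 0 v) = r"
      if "has_bochner_integral lborel (\<lambda>x. normal_density 0 (sqrt v) x * h x) r"
        and "h \<in> borel_measurable borel" for h r
      unfolding g using that 
      by (auto simp: integrable_density integral_density has_bochner_integral_iff)
    have "2 / pi \<le> 1" using pi_gt3 by simp
    then have le: "2 * sqrt v ^ 3 * sqrt (2 / pi) \<le> 2 * sqrt v ^ 3"
      using 2 by (intro mult_left_le) auto
    have m1: "has_bochner_integral lborel (\<lambda>x. normal_density 0 (sqrt v) x * x) 0"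
      using normal_moment_odd[OF s, of 0 0] by simp
    have m2: "has_bochner_integral lborel (\<lambda>x. normal_density 0 (sqrt v) x * x\<^sup>2) v"
      using normal_moment_even[OF s, of 0 1] 2 by simp
    have three: "2 * 1 + 1 = (3 :: nat)" by simp
    have m3: "has_bochner_integral lborel (\<lambda>x. normal_density 0 (sqrt v) x * \<bar>x\<bar> ^ 3)
        (2 * sqrt v ^ 3 * sqrt (2 / pi))"
      using normal_moment_abs_odd[OF s, of 0 1] unfolding three by simp
    have "(\<lambda>t::real. t) \<in> borel_measurable borel" "(\<lambda>t::real. t\<^sup>2) \<in> borel_measurable borel"
      "(\<lambda>t::real. \<bar>t\<bar> ^ 3) \<in> borel_measurable borel"
      by measurable
    note r = *[OF m1 this(1)] *[OF m2 this(2)] *[OF m3 this(3)]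
    show ?thesis unfolding r(2,4,6) by (intro conjI refl r le)
  qed
  then show "integrable (gaussian 0 v) (\<lambda>t. t)" "(\<integral>t. t \<partial>gaussian 0 v) = 0"
    and "integrable (gaussian 0 v) (\<lambda>t. t\<^sup>2)" "(\<integral>t. t\<^sup>2 \<partial>gaussian 0 v) = v"
    and "integrable (gaussian 0 v) (\<lambda>t. \<bar>t\<bar> ^ 3)" "(\<integral>t. \<bar>t\<bar> ^ 3 \<partial>gaussian 0 v) \<le> 2 * sqrt v ^ 3"
    by auto
qed

lemma cube_add_le: "0 \<le> x \<Longrightarrow> 0 \<le> y \<Longrightarrow> (x + y) ^ 3 \<le> 4 * x ^ 3 + 4 * (y :: real) ^ 3"
proof -
  assume "0 \<le> x" "0 \<le> y"
  then have "0 \<le> 3 * (x + y) * (x - y)\<^sup>2" by simp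
  then show ?thesis by (simp add: eval_nat_numeral algebra_simps)
qed

text \<open>The factor \<open>8\<close> combines the \<open>4\<close> of the convexity bound \<open>cube_add_le\<close> with
  \<open>E|G|\<^sup>3 \<le> 2 v\<^bsup>3/2\<^esup>\<close>.\<close>
lemma affine_gaussian_moments:
  assumes N: "prob_space N" and [measurable]: "G \<in> borel_measurable N"
    and G: "distr N borel G = gaussian 0 v" and v: "0 \<le> v" and ms: "0 \<le> m" "0 \<le> s"
  shows "(\<integral>\<omega>. m + s * G \<omega> \<partial>N) = m"
    and "integrable N (\<lambda>\<omega>. (m + s * G \<omega>)\<^sup>2)" and "(\<integral>\<omega>. (m + s * G \<omega>)\<^sup>2 \<partial>N) = m\<^sup>2 + s\<^sup>2 * v"
    and "integrable N (\<lambda>\<omega>. \<bar>m + s * G \<omega>\<bar> ^ 3)"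
    and "(\<integral>\<omega>. \<bar>m + s * G \<omega>\<bar> ^ 3 \<partial>N) \<le> 4 * m ^ 3 + 8 * (s * sqrt v) ^ 3"
proof -
  interpret prob_space N by (rule N)
  have tr: "integrable N (\<lambda>\<omega>. h (G \<omega>)) = integrable (gaussian 0 v) h"
     "(\<integral>\<omega>. h (G \<omega>) \<partial>N) = (\<integral>t. h t \<partial>gaussian 0 v)"
    if "h \<in> borel_measurable borel" for h :: "real \<Rightarrow> real"
    unfolding G[symmetric] using that by (auto simp: integrable_distr_eq integral_distr)
  have M: "(\<lambda>t. t) \<in> borel_measurable borel" "(\<lambda>t::real. t\<^sup>2) \<in> borel_measurable borel"
    "(\<lambda>t::real. \<bar>t\<bar> ^ 3) \<in> borel_measurable borel"
    by measurable
  note g = gaussian_moments[OF v]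
  have 1: "integrable N G" "(\<integral>\<omega>. G \<omega> \<partial>N) = 0"
    using g unfolding tr[OF M(1)] by simp_all
  have 2: "integrable N (\<lambda>\<omega>. (G \<omega>)\<^sup>2)" "(\<integral>\<omega>. (G \<omega>)\<^sup>2 \<partial>N) = v"
    using g unfolding tr[OF M(2)] by simp_all
  have 3: "integrable N (\<lambda>\<omega>. \<bar>G \<omega>\<bar> ^ 3)" "(\<integral>\<omega>. \<bar>G \<omega>\<bar> ^ 3 \<partial>N) \<le> 2 * sqrt v ^ 3"
    using g unfolding tr[OF M(3)] by simp_all
  show "(\<integral>\<omega>. m + s * G \<omega> \<partial>N) = m" using 1 by (simp add: prob_space)
  have eq: "(m + s * G \<omega>)\<^sup>2 = m\<^sup>2 + 2 * m * s * G \<omega> + s\<^sup>2 * (G \<omega>)\<^sup>2" for \<omega>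
    by (simp add: power2_eq_square algebra_simps)
  show "integrable N (\<lambda>\<omega>. (m + s * G \<omega>)\<^sup>2)" unfolding eq using 1 2 by simp
  show "(\<integral>\<omega>. (m + s * G \<omega>)\<^sup>2 \<partial>N) = m\<^sup>2 + s\<^sup>2 * v" unfolding eq using 1 2 by (simp add: prob_space)
  have le: "\<bar>m + s * G \<omega>\<bar> ^ 3 \<le> 4 * m ^ 3 + 4 * s ^ 3 * \<bar>G \<omega>\<bar> ^ 3" for \<omega>
  proof -
    have "\<bar>m + s * G \<omega>\<bar> \<le> m + s * \<bar>G \<omega>\<bar>"
      using abs_triangle_ineq[of m "s * G \<omega>"] ms by (simp add: abs_mult)
    then have "\<bar>m + s * G \<omega>\<bar> ^ 3 \<le> (m + s * \<bar>G \<omega>\<bar>) ^ 3" by (rule power_mono) simp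
    also have "\<dots> \<le> 4 * m ^ 3 + 4 * (s * \<bar>G \<omega>\<bar>) ^ 3" by (rule cube_add_le) (use ms in auto)
    finally show ?thesis by (simp add: power_mult_distrib)
  qed
  have dom: "integrable N (\<lambda>\<omega>. 4 * m ^ 3 + 4 * s ^ 3 * \<bar>G \<omega>\<bar> ^ 3)" using 3 by simp
  show int: "integrable N (\<lambda>\<omega>. \<bar>m + s * G \<omega>\<bar> ^ 3)"
    by (rule Bochner_Integration.integrable_bound[OF dom], measurable)
       (rule AE_I2, use le in \<open>simp add: order_trans[OF _ abs_ge_self]\<close>)
  have "(\<integral>\<omega>. \<bar>m + s * G \<omega>\<bar> ^ 3 \<partial>N) \<le> (\<integral>\<omega>. 4 * m ^ 3 + 4 * s ^ 3 * \<bar>G \<omega>\<bar> ^ 3 \<partial>N)"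
    by (rule integral_mono[OF int dom le])
  also have "\<dots> = 4 * m ^ 3 + 4 * s ^ 3 * (\<integral>\<omega>. \<bar>G \<omega>\<bar> ^ 3 \<partial>N)" using 3 by (simp add: prob_space)
  also have "\<dots> \<le> 4 * m ^ 3 + 4 * s ^ 3 * (2 * sqrt v ^ 3)"
    using 3(2) ms by (intro add_left_mono mult_left_mono) auto
  finally show "(\<integral>\<omega>. \<bar>m + s * G \<omega>\<bar> ^ 3 \<partial>N) \<le> 4 * m ^ 3 + 8 * (s * sqrt v) ^ 3"
    by (simp add: power_mult_distrib)
qed

text \<open>For a sparse coupling the third moment is of the same order in \<open>n\<close> as the second; it is the part
  of the replacement error that survives the limit \<open>n \<rightarrow> \<infinity>\<close> and limits the precision of this argument to \<open>d\<^bsup>1/3\<^esup>\<close>.\<close>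
lemma bounded_third_moment:
  fixes W :: "'w \<Rightarrow> real"
  assumes M: "prob_space M" and [measurable]: "W \<in> borel_measurable M" and B: "AE \<omega> in M. \<bar>W \<omega>\<bar> \<le> B"
  shows "integrable M (\<lambda>\<omega>. (W \<omega>)\<^sup>2)" and "integrable M (\<lambda>\<omega>. \<bar>W \<omega>\<bar> ^ 3)"
    and "(\<integral>\<omega>. \<bar>W \<omega>\<bar> ^ 3 \<partial>M) \<le> B * (\<integral>\<omega>. (W \<omega>)\<^sup>2 \<partial>M)"
proof -
  interpret prob_space M by (rule M)
  show 2: "integrable M (\<lambda>\<omega>. (W \<omega>)\<^sup>2)"
  proof (rule integrable_const_bound[where B = "B\<^sup>2"])
    show "AE \<omega> in M. norm ((W \<omega>)\<^sup>2) \<le> B\<^sup>2"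
      using B by eventually_elim (metis abs_ge_zero power_mono power2_abs real_norm_def abs_power2)
  qed measurable
  show 3: "integrable M (\<lambda>\<omega>. \<bar>W \<omega>\<bar> ^ 3)"
  proof (rule integrable_const_bound[where B = "B ^ 3"])
    show "AE \<omega> in M. norm (\<bar>W \<omega>\<bar> ^ 3) \<le> B ^ 3"
      using B by eventually_elim (simp add: power_mono)
  qed measurable
  have "(\<integral>\<omega>. \<bar>W \<omega>\<bar> ^ 3 \<partial>M) \<le> (\<integral>\<omega>. B * (W \<omega>)\<^sup>2 \<partial>M)"
  proof (rule integral_mono_AE[OF 3])
    show "AE \<omega> in M. \<bar>W \<omega>\<bar> ^ 3 \<le> B * (W \<omega>)\<^sup>2"
      using B
    proof eventually_elim
      case (elim \<omega>)
      then have "\<bar>W \<omega>\<bar> * (W \<omega>)\<^sup>2 \<le> B * (W \<omega>)\<^sup>2" by (rule mult_right_mono) simp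
      then show ?case by (simp add: power3_eq_cube power2_eq_square)
    qed
  qed (use 2 in simp)
  then show "(\<integral>\<omega>. \<bar>W \<omega>\<bar> ^ 3 \<partial>M) \<le> B * (\<integral>\<omega>. (W \<omega>)\<^sup>2 \<partial>M)" by simp
qed

section \<open>From independent random variables to product measures\<close>

text \<open>Outside \<open>I\<close> a point mass is used, so that every member of the family is a probability
  measure.\<close>
definition laws :: "'w measure \<Rightarrow> 'i set \<Rightarrow> ('i \<Rightarrow> 'w \<Rightarrow> real) \<Rightarrow> 'i \<Rightarrow> real measure" where
  "laws M I Y i = (if i \<in> I then distr M borel (Y i) else return borel 0)"

lemma square_integrable_laws_laws:
  assumes "prob_space M" and "\<And>i. i \<in> I \<Longrightarrow> Y i \<in> borel_measurable M"
    and "\<And>i. i \<in> I \<Longrightarrow> integrable M (\<lambda>\<omega>. (Y i \<omega>)\<^sup>2)"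
  shows "square_integrable_laws (laws M I Y)"
proof (rule square_integrable_laws.intro)
  fix i
  show "prob_space (laws M I Y i)"
    using assms by (auto simp: laws_def intro!: prob_space.prob_space_distr prob_space_return)
  show "sets (laws M I Y i) = sets borel" by (auto simp: laws_def)
  show "integrable (laws M I Y i) (\<lambda>t. t\<^sup>2)"
    using assms by (auto simp: laws_def integrable_return_borel integrable_distr_eq)
qed

text \<open>Independence says that the joint law is the product of the marginal laws.\<close>
lemma expectation_eq_integral_laws:
  assumes M: "prob_space M" and indep: "prob_space.indep_vars M (\<lambda>_. borel) Y I" and "I \<noteq> {}"
    and F: "F \<in> borel_measurable (Pi\<^sub>M I (\<lambda>_. borel))"
  shows "(\<integral>\<omega>. F (\<lambda>i\<in>I. Y i \<omega>) \<partial>M) = (\<integral>x. F x \<partial>Pi\<^sub>M I (laws M I Y) :: real)"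
    and "integrable (Pi\<^sub>M I (laws M I Y)) F \<Longrightarrow> integrable M (\<lambda>\<omega>. F (\<lambda>i\<in>I. Y i \<omega>))"
proof -
  interpret prob_space M by (rule M)
  have Y[measurable]: "\<And>i. i \<in> I \<Longrightarrow> Y i \<in> borel_measurable M"
    using indep unfolding indep_vars_def by auto
  have Y': "(\<lambda>\<omega>. \<lambda>i\<in>I. Y i \<omega>) \<in> measurable M (Pi\<^sub>M I (\<lambda>_. borel))"
    by (rule measurable_restrict) (rule Y)
  have "distr M (Pi\<^sub>M I (\<lambda>_. borel)) (\<lambda>\<omega>. \<lambda>i\<in>I. Y i \<omega>) = Pi\<^sub>M I (\<lambda>i. distr M borel (Y i))"
    using indep_vars_iff_distr_eq_PiM'[of I Y "\<lambda>_. borel", OF \<open>I \<noteq> {}\<close> Y] indep by blast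
  also have "\<dots> = Pi\<^sub>M I (laws M I Y)" by (rule PiM_cong) (auto simp: laws_def)
  finally have eq: "distr M (Pi\<^sub>M I (\<lambda>_. borel)) (\<lambda>\<omega>. \<lambda>i\<in>I. Y i \<omega>) = Pi\<^sub>M I (laws M I Y)" .
  show "(\<integral>\<omega>. F (\<lambda>i\<in>I. Y i \<omega>) \<partial>M) = (\<integral>x. F x \<partial>Pi\<^sub>M I (laws M I Y))"
    unfolding eq[symmetric] by (rule integral_distr[OF Y' F, symmetric])
  show "integrable (Pi\<^sub>M I (laws M I Y)) F \<Longrightarrow> integrable M (\<lambda>\<omega>. F (\<lambda>i\<in>I. Y i \<omega>))"
    unfolding eq[symmetric] by (rule integrable_distr[OF Y'])
qed

lemma concentration_coordinate_lipschitz: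
  assumes M: "prob_space M" and indep: "prob_space.indep_vars M (\<lambda>_. borel) Y I" and "I \<noteq> {}" "finite I"
    and F: "coordinate_lipschitz I c F" and c: "\<And>i. i \<in> I \<Longrightarrow> 0 \<le> c i"
    and Y2: "\<And>i. i \<in> I \<Longrightarrow> integrable M (\<lambda>\<omega>. (Y i \<omega>)\<^sup>2)" and r: "0 < r"
  shows "measure M {\<omega>\<in>space M. r \<le> \<bar>F (\<lambda>i\<in>I. Y i \<omega>) - (\<integral>\<omega>. F (\<lambda>i\<in>I. Y i \<omega>) \<partial>M)\<bar>}
    \<le> (\<Sum>i\<in>I. (c i)\<^sup>2 * (\<integral>\<omega>. (Y i \<omega>)\<^sup>2 \<partial>M)) / r\<^sup>2"
proof -
  interpret prob_space M by (rule M)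
  have Y[measurable]: "\<And>i. i \<in> I \<Longrightarrow> Y i \<in> borel_measurable M"
    using indep unfolding indep_vars_def by auto
  interpret L: square_integrable_laws "laws M I Y"
    by (rule square_integrable_laws_laws[OF M Y Y2])
  have [measurable]: "F \<in> borel_measurable (Pi\<^sub>M I (\<lambda>_. borel))"
    using F unfolding coordinate_lipschitz_def by auto
  let ?Z = "\<lambda>\<omega>. F (\<lambda>i\<in>I. Y i \<omega>)"
  note E = expectation_eq_integral_laws[OF M indep \<open>I \<noteq> {}\<close>]
  have Z1: "integrable M ?Z"
    by (rule E(2)) (use L.integrable_coordinate_lipschitz[OF F \<open>finite I\<close> c] in auto)
  have Z2: "integrable M (\<lambda>\<omega>. (?Z \<omega>)\<^sup>2)"
    by (rule E(2)) (use L.integrable_coordinate_lipschitz_square[OF F \<open>finite I\<close> c] in auto)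
  have "variance ?Z = (\<integral>x. (F x)\<^sup>2 \<partial>Pi\<^sub>M I (laws M I Y)) - (\<integral>x. F x \<partial>Pi\<^sub>M I (laws M I Y))\<^sup>2"
    unfolding variance_eq[OF Z1 Z2] by (subst E(1), measurable)+
  also have "\<dots> \<le> (\<Sum>i\<in>I. (c i)\<^sup>2 * (\<integral>t. t\<^sup>2 \<partial>laws M I Y i))"
    by (rule L.variance_coordinate_lipschitz[OF \<open>finite I\<close> F c])
  also have "\<dots> = (\<Sum>i\<in>I. (c i)\<^sup>2 * (\<integral>\<omega>. (Y i \<omega>)\<^sup>2 \<partial>M))"
    by (rule sum.cong) (auto simp: laws_def integral_distr)
  finally have "variance ?Z / r\<^sup>2 \<le> (\<Sum>i\<in>I. (c i)\<^sup>2 * (\<integral>\<omega>. (Y i \<omega>)\<^sup>2 \<partial>M)) / r\<^sup>2"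
    by (rule divide_right_mono) simp
  with Chebyshev_inequality[of ?Z r] Z1 Z2 r show ?thesis by simp
qed

section \<open>Symmetric arrays as independent couplings\<close>

lemma finite_distinct_tuples: "finite (distinct_tuples p n)"
  and card_distinct_tuples_le: "card (distinct_tuples p n) \<le> n ^ p"
proof -
  have sub: "distinct_tuples p n \<subseteq> {xs. set xs \<subseteq> {1..n} \<and> length xs = p}"
    by (auto simp: distinct_tuples_def)
  have fin: "finite {xs. set xs \<subseteq> {1..n} \<and> length xs = p}" by (rule finite_lists_length_eq) simp
  show "finite (distinct_tuples p n)" by (rule finite_subset[OF sub fin])
  show "card (distinct_tuples p n) \<le> n ^ p"
    using card_mono[OF fin sub] card_lists_length_eq[of "{1..n}" p] by simp
qed

lemma increasing_tuples_subset: "increasing_tuples p n \<subseteq> distinct_tuples p n"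
  by (auto simp: increasing_tuples_def distinct_tuples_def strict_sorted_iff)

lemma finite_increasing_tuples: "finite (increasing_tuples p n)"
  and card_increasing_tuples_le: "card (increasing_tuples p n) \<le> n ^ p"
  using finite_subset[OF increasing_tuples_subset finite_distinct_tuples]
    card_mono[OF finite_distinct_tuples increasing_tuples_subset, of p n] card_distinct_tuples_le[of p n]
  by auto

lemma increasing_tuples_nonempty: "p \<le> n \<Longrightarrow> increasing_tuples p n \<noteq> {}"
proof -
  assume "p \<le> n"
  then have "[1..<Suc p] \<in> increasing_tuples p n" by (auto simp: increasing_tuples_def simp del: upt_Suc)
  then show ?thesis by blast
qed

lemma sort_distinct_tuple: "is \<in> distinct_tuples p n \<Longrightarrow> sort is \<in> increasing_tuples p n"
  by (auto simp: increasing_tuples_def distinct_tuples_def strict_sorted_iff)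

lemma symmetric_on_sort:
  assumes "symmetric_on D F" "is \<in> D"
  shows "F (sort is) = F (is :: 'c :: linorder list)"
proof -
  obtain \<pi> where "\<pi> permutes {..<length is}" "permute_list \<pi> is = sort is"
    by (rule mset_eq_permutation[of "sort is" "is"]) auto
  then show ?thesis using assms unfolding symmetric_on_def by metis
qed

text \<open>A symmetric array is determined by its independent entries at increasing tuples. Collecting
  all orderings of an increasing tuple \<open>e\<close> gives the coefficient of its entry in the tuple sum.\<close>
definition orbit_sum :: "nat \<Rightarrow> nat \<Rightarrow> ('x list \<Rightarrow> real) \<Rightarrow> (nat \<Rightarrow> 'x) \<Rightarrow> nat list \<Rightarrow> real" where
  "orbit_sum p n f \<sigma> e = (\<Sum>is | is \<in> distinct_tuples p n \<and> sort is = e. f (map \<sigma> is))"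

lemma tuple_sum_eq_orbit_sum:
  assumes "\<And>is. is \<in> distinct_tuples p n \<Longrightarrow> y (sort is) = y is"
  shows "tuple_sum p n f y \<sigma> = (\<Sum>e\<in>increasing_tuples p n. orbit_sum p n f \<sigma> e * y e)"
proof -
  have "tuple_sum p n f y \<sigma> = (\<Sum>is\<in>distinct_tuples p n. f (map \<sigma> is) * y (sort is))"
    unfolding tuple_sum_def using assms by (intro sum.cong) (auto simp: mult.commute)
  also have "\<dots> = (\<Sum>e\<in>increasing_tuples p n.
      \<Sum>is | is \<in> distinct_tuples p n \<and> sort is = e. f (map \<sigma> is) * y (sort is))"
    by (rule sum.group[symmetric]) (auto simp: finite_distinct_tuples finite_increasing_tuples sort_distinct_tuple)
  also have "\<dots> = (\<Sum>e\<in>increasing_tuples p n. orbit_sum p n f \<sigma> e * y e)"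
    unfolding orbit_sum_def sum_distrib_right by (intro sum.cong) auto
  finally show ?thesis .
qed

text \<open>The orderings of \<open>e\<close> are among the \<open>p\<^sup>p\<close> lists of length \<open>p\<close> over its entries. This crude count
  suffices because it depends on neither \<open>n\<close> nor \<open>d\<close>.\<close>
lemma orbit_sum_bound:
  assumes f: "\<And>xs. length xs = p \<Longrightarrow> set xs \<subseteq> X \<Longrightarrow> \<bar>f xs\<bar> \<le> C"
    and \<sigma>: "\<sigma> \<in> {1..n} \<rightarrow>\<^sub>E X" and e: "e \<in> increasing_tuples p n" and C: "0 \<le> C"
  shows "\<bar>orbit_sum p n f \<sigma> e\<bar> \<le> real p ^ p * C"
proof -
  let ?O = "{is. is \<in> distinct_tuples p n \<and> sort is = e}"
  have sub: "?O \<subseteq> {is. set is \<subseteq> set e \<and> length is = p}"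
    by (auto simp: distinct_tuples_def)
  have "card ?O \<le> card (set e) ^ p"
    using card_mono[OF finite_lists_length_eq sub] card_lists_length_eq[of "set e" p] by simp
  also have "card (set e) = p"
    using e by (auto simp: increasing_tuples_def strict_sorted_iff distinct_card)
  finally have card: "real (card ?O) \<le> real p ^ p" by (metis of_nat_le_iff of_nat_power)
  have "\<bar>orbit_sum p n f \<sigma> e\<bar> \<le> (\<Sum>is\<in>?O. \<bar>f (map \<sigma> is)\<bar>)"
    unfolding orbit_sum_def by (rule sum_abs)
  also have "\<dots> \<le> (\<Sum>is\<in>?O. C)"
  proof (rule sum_mono, rule f)
    fix "is" assume "is \<in> ?O"
    then have "length is = p" "set is \<subseteq> {1..n}" by (auto simp: distinct_tuples_def)
    then show "length (map \<sigma> is) = p" "set (map \<sigma> is) \<subseteq> X" using \<sigma> by auto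
  qed
  also have "\<dots> \<le> real p ^ p * C" using card C by (simp add: mult_right_mono)
  finally show ?thesis .
qed

text \<open>The real-valued counterpart of \<open>V_n\<close>, meaningful for a finite nonempty set of
  configurations.\<close>
definition ground_value :: "nat \<Rightarrow> nat \<Rightarrow> ('x list \<Rightarrow> real) \<Rightarrow> (nat \<Rightarrow> 'x) set \<Rightarrow> (nat list \<Rightarrow> real) \<Rightarrow> real" where
  "ground_value p n f S y = (MAX \<sigma>\<in>S. tuple_sum p n f y \<sigma>) / real n"

lemma measurable_ground_value:
  assumes "finite S" "S \<noteq> {}" and [measurable]: "\<And>is. is \<in> distinct_tuples p n \<Longrightarrow> Y is \<in> borel_measurable M"
  shows "(\<lambda>\<omega>. ground_value p n f S (\<lambda>is. Y is \<omega>)) \<in> borel_measurable M"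
  unfolding ground_value_def tuple_sum_def
  by (intro borel_measurable_divide borel_measurable_Max borel_measurable_const)
     (use assms in measurable)

lemma integrable_ground_value:
  assumes "finite S" "S \<noteq> {}" and "\<And>is. is \<in> distinct_tuples p n \<Longrightarrow> integrable M (Y is)"
  shows "integrable M (\<lambda>\<omega>. ground_value p n f S (\<lambda>is. Y is \<omega>))"
  unfolding ground_value_def tuple_sum_def
  using assms by (intro integrable_divide integrable_MAX Bochner_Integration.integrable_sum integrable_mult_left) auto

lemma symmetric_array_sort:
  assumes "symmetric_array M p n Y" "\<omega> \<in> space M" "is \<in> distinct_tuples p n"
  shows "Y (sort is) \<omega> = Y is \<omega>"
  using assms symmetric_on_sort[of "distinct_tuples p n" "\<lambda>is. Y is \<omega>" "is"]
  by (auto simp: symmetric_array_def)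

lemma symmetric_array_measurable:
  assumes "prob_space M" "symmetric_array M p n Y" "is \<in> distinct_tuples p n"
  shows "Y is \<in> borel_measurable M"
proof -
  have "Y (sort is) \<in> borel_measurable M"
    using assms sort_distinct_tuple[OF assms(3)]
    by (auto simp: symmetric_array_def prob_space.indep_vars_def)
  then show ?thesis
    using symmetric_array_sort[OF assms(2) _ assms(3)] by (subst measurable_cong[symmetric]) auto
qed

section \<open>The Gaussian variational formula as a ground value\<close>

lemma SUP_ereal_eq_MAX:
  assumes "finite S" "S \<noteq> {}"
  shows "(SUP \<sigma>\<in>S. ereal (h \<sigma>)) = ereal (MAX \<sigma>\<in>S. h \<sigma>)"
proof (rule antisym)
  show "(SUP \<sigma>\<in>S. ereal (h \<sigma>)) \<le> ereal (MAX \<sigma>\<in>S. h \<sigma>)"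
    by (rule SUP_least) (use assms in auto)
  have "(MAX \<sigma>\<in>S. h \<sigma>) \<in> h ` S" by (rule Max_in) (use assms in auto)
  then obtain \<tau> where "(MAX \<sigma>\<in>S. h \<sigma>) = h \<tau>" "\<tau> \<in> S" by (rule imageE)
  then show "ereal (MAX \<sigma>\<in>S. h \<sigma>) \<le> (SUP \<sigma>\<in>S. ereal (h \<sigma>))" by (auto intro: SUP_upper)
qed

lemma V_n_eq_ground_value:
  assumes "finite S" "S \<noteq> {}" "n \<ge> 1"
  shows "V_n p n f S y = ereal (ground_value p n f S y)"
  unfolding V_n_def ground_value_def SUP_ereal_eq_MAX[OF assms(1,2)] using assms by simp

text \<open>The Gaussian couplings, shifted to the mean of the sparse couplings and rescaled so that their
  variance is the second moment of the sparse couplings.\<close>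
definition shifted_field :: "nat \<Rightarrow> nat \<Rightarrow> real \<Rightarrow> (nat list \<Rightarrow> real) \<Rightarrow> (nat list \<Rightarrow> real) \<Rightarrow> nat list \<Rightarrow> real" where
  "shifted_field p n d \<kappa>\<^sub>1 j is = d * \<kappa>\<^sub>1 is / real n ^ (p - 1) + sqrt d / real n powr ((real p - 1) / 2) * j is"

lemma tuple_sum_shifted_field:
  assumes "n \<ge> 1" "p \<ge> 1"
  shows "tuple_sum p n f (shifted_field p n d \<kappa>\<^sub>1 j) \<sigma> / real n =
    1 / real n ^ p * tuple_sum p n f \<kappa>\<^sub>1 \<sigma> * d
      + tuple_sum p n f (\<lambda>is. j is / real n powr ((real p - 1) / 2)) \<sigma> / real n * sqrt d"
proof -
  have "real n ^ p = real n ^ (p - 1) * real n"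
    using assms by (simp add: power_eq_if)
  then show ?thesis
    unfolding tuple_sum_def shifted_field_def sum_distrib_left sum_distrib_right sum_divide_distrib
      sum.distrib[symmetric]
    using assms by (intro sum.cong) (simp_all add: field_simps)
qed

text \<open>By \<open>tuple_sum_shifted_field\<close>, a configuration at level \<open>\<alpha>\<close> contributes exactly \<open>\<alpha> d\<close> plus its
  Gaussian energy. The nested suprema, over the levels and over the configurations at a level,
  range over each configuration once; a level without configurations contributes \<open>-\<infinity>\<close>.\<close>
lemma SUP_level_eq_ground_value:
  assumes S: "finite S" "S \<noteq> {}" and n: "n \<ge> 1" and p: "p \<ge> 1" and d: "d > 0"
  shows "(SUP \<alpha>::real. ereal (\<alpha> * d) + T_n p n f S \<kappa>\<^sub>1 j \<alpha> * ereal (sqrt d))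
    = ereal (ground_value p n f S (shifted_field p n d \<kappa>\<^sub>1 j))"
proof -
  define level where "level \<sigma> = 1 / real n ^ p * tuple_sum p n f \<kappa>\<^sub>1 \<sigma>" for \<sigma>
  define g where "g \<sigma> = tuple_sum p n f (\<lambda>is. j is / real n powr ((real p - 1) / 2)) \<sigma>" for \<sigma>
  define h where "h \<sigma> = tuple_sum p n f (shifted_field p n d \<kappa>\<^sub>1 j) \<sigma>" for \<sigma>
  have h: "h \<sigma> / real n = level \<sigma> * d + g \<sigma> / real n * sqrt d" for \<sigma>
    unfolding h_def level_def g_def by (rule tuple_sum_shifted_field[OF n p])
  have T: "T_n p n f S \<kappa>\<^sub>1 j \<alpha> = (SUP \<sigma>\<in>{\<sigma>\<in>S. level \<sigma> = \<alpha>}. ereal (g \<sigma>)) / ereal (real n)" for \<alpha>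
    by (simp add: T_n_def level_def g_def)
  have T_real: "T_n p n f S \<kappa>\<^sub>1 j \<alpha> = ereal ((MAX \<sigma>\<in>{\<sigma>\<in>S. level \<sigma> = \<alpha>}. g \<sigma>) / real n)"
    if "{\<sigma>\<in>S. level \<sigma> = \<alpha>} \<noteq> {}" for \<alpha>
    unfolding T using that S n by (subst SUP_ereal_eq_MAX) auto
  have gv: "ground_value p n f S (shifted_field p n d \<kappa>\<^sub>1 j) = (MAX \<sigma>\<in>S. h \<sigma>) / real n"
    by (simp add: ground_value_def h_def)
  show ?thesis unfolding gv
  proof (rule antisym)
    show "(SUP \<alpha>::real. ereal (\<alpha> * d) + T_n p n f S \<kappa>\<^sub>1 j \<alpha> * ereal (sqrt d)) \<le> ereal ((MAX \<sigma>\<in>S. h \<sigma>) / real n)"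
    proof (rule SUP_least)
      fix \<alpha> :: real
      show "ereal (\<alpha> * d) + T_n p n f S \<kappa>\<^sub>1 j \<alpha> * ereal (sqrt d) \<le> ereal ((MAX \<sigma>\<in>S. h \<sigma>) / real n)"
      proof (cases "{\<sigma>\<in>S. level \<sigma> = \<alpha>} = {}")
        case True
        then have "T_n p n f S \<kappa>\<^sub>1 j \<alpha> = - \<infinity>"
          unfolding T True using n by (simp add: bot_ereal_def)
        then show ?thesis using d by simp
      next
        case False
        have "(MAX \<sigma>\<in>{\<sigma>\<in>S. level \<sigma> = \<alpha>}. g \<sigma>) \<in> g ` {\<sigma>\<in>S. level \<sigma> = \<alpha>}"
          by (rule Max_in) (use S False in auto)
        then obtain \<tau> where \<tau>: "(MAX \<sigma>\<in>{\<sigma>\<in>S. level \<sigma> = \<alpha>}. g \<sigma>) = g \<tau>" "\<tau> \<in> {\<sigma>\<in>S. level \<sigma> = \<alpha>}"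
          by (rule imageE)
        have "h \<tau> / real n \<le> (MAX \<sigma>\<in>S. h \<sigma>) / real n"
          using S \<tau> by (intro divide_right_mono Max_ge) auto
        then show ?thesis unfolding T_real[OF False] \<tau>(1) using \<tau>(2) h[of \<tau>] by simp
      qed
    qed
    have "(MAX \<sigma>\<in>S. h \<sigma>) \<in> h ` S" by (rule Max_in) (use S in auto)
    then obtain \<tau> where \<tau>: "(MAX \<sigma>\<in>S. h \<sigma>) = h \<tau>" "\<tau> \<in> S" by (rule imageE)
    have ne: "{\<sigma>\<in>S. level \<sigma> = level \<tau>} \<noteq> {}" using \<tau> by auto
    have "g \<tau> / real n * sqrt d \<le> (MAX \<sigma>\<in>{\<sigma>\<in>S. level \<sigma> = level \<tau>}. g \<sigma>) / real n * sqrt d"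
      using S \<tau> d by (intro mult_right_mono divide_right_mono Max_ge) auto
    then have "ereal ((MAX \<sigma>\<in>S. h \<sigma>) / real n)
        \<le> ereal (level \<tau> * d) + T_n p n f S \<kappa>\<^sub>1 j (level \<tau>) * ereal (sqrt d)"
      unfolding T_real[OF ne] \<tau>(1) using h[of \<tau>] by simp
    then show "ereal ((MAX \<sigma>\<in>S. h \<sigma>) / real n)
        \<le> (SUP \<alpha>::real. ereal (\<alpha> * d) + T_n p n f S \<kappa>\<^sub>1 j \<alpha> * ereal (sqrt d))"
      by (rule order_trans) (rule SUP_upper, simp)
  qed
qed

lemma symmetric_array_shifted_field:
  assumes N: "prob_space N" and J: "symmetric_array N p n J" and k: "symmetric_kernel p \<kappa>\<^sub>1"
  shows "symmetric_array N p n (\<lambda>is \<omega>. shifted_field p n d \<kappa>\<^sub>1 (\<lambda>is. J is \<omega>) is)"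
proof -
  interpret prob_space N by (rule N)
  have "symmetric_on (distinct_tuples p n) (\<lambda>is. shifted_field p n d \<kappa>\<^sub>1 (\<lambda>is. J is \<omega>) is)"
    if "\<omega> \<in> space N" for \<omega>
    using J k that
    by (auto simp: symmetric_on_def symmetric_array_def symmetric_kernel_def shifted_field_def distinct_tuples_def)
  moreover have "indep_vars (\<lambda>_. borel) (\<lambda>is \<omega>. shifted_field p n d \<kappa>\<^sub>1 (\<lambda>is. J is \<omega>) is) (increasing_tuples p n)"
    unfolding shifted_field_def
    by (rule indep_vars_compose2[where M' = "\<lambda>_. borel" and
        Y = "\<lambda>is x. d * \<kappa>\<^sub>1 is / real n ^ (p - 1) + sqrt d / real n powr ((real p - 1) / 2) * x"])
       (use J in \<open>auto simp: symmetric_array_def\<close>)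
  ultimately show ?thesis by (auto simp: symmetric_array_def)
qed

lemma ereal_expectation_real:
  assumes "integrable M h"
  shows "ereal_expectation M (\<lambda>\<omega>. ereal (h \<omega>)) = ereal (\<integral>\<omega>. h \<omega> \<partial>M)"
proof -
  have fin: "(\<integral>\<^sup>+\<omega>. ennreal (h \<omega>) \<partial>M) \<noteq> \<infinity>" "(\<integral>\<^sup>+\<omega>. ennreal (- h \<omega>) \<partial>M) \<noteq> \<infinity>"
    using real_integrable_def[of M h] assms by auto
  then obtain a b where ab: "(\<integral>\<^sup>+\<omega>. ennreal (h \<omega>) \<partial>M) = ennreal a" "0 \<le> a"
      "(\<integral>\<^sup>+\<omega>. ennreal (- h \<omega>) \<partial>M) = ennreal b" "0 \<le> b"
    by (metis ennreal_cases infinity_ennreal_def)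
  then show ?thesis
    unfolding ereal_expectation_def real_lebesgue_integral_def[OF assms]
    by (simp add: enn2ereal_ennreal)
qed

lemma ereal_expectation_bot:
  assumes "prob_space M"
  shows "ereal_expectation M (\<lambda>_. - \<infinity>) = - \<infinity>"
proof -
  interpret prob_space M by (rule assms)
  show ?thesis
    by (simp add: ereal_expectation_def e2ennreal_neg emeasure_space_1 zero_ennreal.rep_eq)
qed

lemma ereal_expectation_ground_value:
  assumes p: "1 \<le> p" and n: "1 \<le> n" and S: "finite S" "S \<noteq> {}" and d: "0 < d"
    and k2: "symmetric_kernel p \<kappa>\<^sub>2" and J: "gaussian_array N p n \<kappa>\<^sub>2 J"
  shows "ereal_expectation N
      (\<lambda>\<omega>. SUP \<alpha>::real. ereal (\<alpha> * d) + T_n p n f S \<kappa>\<^sub>1 (\<lambda>is. J is \<omega>) \<alpha> * ereal (sqrt d))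
    = ereal (\<integral>\<omega>. ground_value p n f S (shifted_field p n d \<kappa>\<^sub>1 (\<lambda>is. J is \<omega>)) \<partial>N)"
proof -
  have N: "prob_space N" and J': "symmetric_array N p n J" using J by (auto simp: gaussian_array_def)
  interpret prob_space N by (rule N)
  have "integrable N (J is)" if "is \<in> distinct_tuples p n" for "is"
  proof -
    have "0 \<le> \<kappa>\<^sub>2 is" using k2 that by (auto simp: symmetric_kernel_def distinct_tuples_def)
    then have "integrable (distr N borel (J is)) (\<lambda>t. t)"
      using gaussian_moments(1) J that by (auto simp: gaussian_array_def)
    then show ?thesis
      using symmetric_array_measurable[OF N J' that] by (simp add: integrable_distr_eq)
  qed
  then have "integrable N (\<lambda>\<omega>. ground_value p n f S (\<lambda>is. shifted_field p n d \<kappa>\<^sub>1 (\<lambda>is. J is \<omega>) is))"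
    by (intro integrable_ground_value S) (simp add: shifted_field_def)
  then show ?thesis
    unfolding SUP_level_eq_ground_value[OF S n p d] by (simp add: ereal_expectation_real)
qed

section \<open>Comparison and concentration of ground values\<close>

context
  fixes p n :: nat and X :: "'x set" and f :: "'x list \<Rightarrow> real" and S :: "(nat \<Rightarrow> 'x) set" and C :: real
  assumes p: "1 \<le> p" "p \<le> n" and S: "finite S" "S \<noteq> {}" "S \<subseteq> {1..n} \<rightarrow>\<^sub>E X"
    and C: "0 \<le> C" and f: "\<And>xs. length xs = p \<Longrightarrow> set xs \<subseteq> X \<Longrightarrow> \<bar>f xs\<bar> \<le> C"
begin

lemma orbit_sum_bound_configuration:
  "\<sigma> \<in> S \<Longrightarrow> e \<in> increasing_tuples p n \<Longrightarrow> \<bar>orbit_sum p n f \<sigma> e\<bar> \<le> real p ^ p * C"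
  by (rule orbit_sum_bound[OF f _ _ C]) (use S in auto)

lemma ground_value_eq_max_linear:
  assumes "symmetric_array M p n W" "\<omega> \<in> space M"
  shows "ground_value p n f S (\<lambda>is. W is \<omega>) =
    max_linear S (increasing_tuples p n) (orbit_sum p n f) (\<lambda>e\<in>increasing_tuples p n. W e \<omega>) / real n"
proof -
  have "tuple_sum p n f (\<lambda>is. W is \<omega>) \<sigma> = (\<Sum>e\<in>increasing_tuples p n.
      orbit_sum p n f \<sigma> e * (\<lambda>e\<in>increasing_tuples p n. W e \<omega>) e)" for \<sigma>
    using tuple_sum_eq_orbit_sum[of p n "\<lambda>is. W is \<omega>" f \<sigma>] symmetric_array_sort[OF assms] by simp
  then show ?thesis by (simp add: ground_value_def max_linear_def)
qed

lemma expectation_ground_value: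
  assumes M: "prob_space M" and W: "symmetric_array M p n W"
  shows "(\<integral>\<omega>. ground_value p n f S (\<lambda>is. W is \<omega>) \<partial>M) =
    (\<integral>\<omega>. max_linear S (increasing_tuples p n) (orbit_sum p n f)
       (\<lambda>e\<in>increasing_tuples p n. W e \<omega>) \<partial>M) / real n"
proof -
  have "(\<integral>\<omega>. ground_value p n f S (\<lambda>is. W is \<omega>) \<partial>M) =
    (\<integral>\<omega>. max_linear S (increasing_tuples p n) (orbit_sum p n f)
       (\<lambda>e\<in>increasing_tuples p n. W e \<omega>) / real n \<partial>M)"
    by (rule Bochner_Integration.integral_cong) (simp_all add: ground_value_eq_max_linear[OF W])
  then show ?thesis by simp
qed

lemma ground_value_comparison:
  assumes M: "prob_space M" and W: "symmetric_array M p n W"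
    and N: "prob_space N" and Y: "symmetric_array N p n Y"
    and sq: "\<And>e. e \<in> distinct_tuples p n \<Longrightarrow> integrable M (\<lambda>\<omega>. (W e \<omega>)\<^sup>2)"
      "\<And>e. e \<in> distinct_tuples p n \<Longrightarrow> integrable N (\<lambda>\<omega>. (Y e \<omega>)\<^sup>2)"
    and cube: "\<And>e. e \<in> distinct_tuples p n \<Longrightarrow> integrable M (\<lambda>\<omega>. \<bar>W e \<omega>\<bar> ^ 3)"
      "\<And>e. e \<in> distinct_tuples p n \<Longrightarrow> integrable N (\<lambda>\<omega>. \<bar>Y e \<omega>\<bar> ^ 3)"
    and mean: "\<And>e. e \<in> distinct_tuples p n \<Longrightarrow> (\<integral>\<omega>. W e \<omega> \<partial>M) = (\<integral>\<omega>. Y e \<omega> \<partial>N)"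
    and second: "\<And>e. e \<in> distinct_tuples p n \<Longrightarrow> \<bar>(\<integral>\<omega>. (W e \<omega>)\<^sup>2 \<partial>M) - (\<integral>\<omega>. (Y e \<omega>)\<^sup>2 \<partial>N)\<bar> \<le> e2"
    and third: "\<And>e. e \<in> distinct_tuples p n \<Longrightarrow> (\<integral>\<omega>. \<bar>W e \<omega>\<bar> ^ 3 \<partial>M) + (\<integral>\<omega>. \<bar>Y e \<omega>\<bar> ^ 3 \<partial>N) \<le> e3"
    and \<beta>: "0 < \<beta>" and e: "0 \<le> e2" "0 \<le> e3"
  shows "\<bar>(\<integral>\<omega>. ground_value p n f S (\<lambda>is. W is \<omega>) \<partial>M) - (\<integral>\<omega>. ground_value p n f S (\<lambda>is. Y is \<omega>) \<partial>N)\<bar>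
    \<le> (ln (card S) / \<beta> + real n ^ p * (\<beta> * (real p ^ p * C)\<^sup>2 * e2 + \<beta>\<^sup>2 * (real p ^ p * C) ^ 3 * e3)) / real n"
proof -
  define I where "I = increasing_tuples p n"
  define b where "b = real p ^ p * C"
  define F where "F = max_linear S I (orbit_sum p n f)"
  have I: "finite I" "I \<noteq> {}" "\<And>e. e \<in> I \<Longrightarrow> e \<in> distinct_tuples p n"
    using finite_increasing_tuples increasing_tuples_nonempty[OF p(2)] increasing_tuples_subset
    unfolding I_def by blast+
  have a: "\<And>\<sigma> e. \<sigma> \<in> S \<Longrightarrow> e \<in> I \<Longrightarrow> \<bar>orbit_sum p n f \<sigma> e\<bar> \<le> b"
    unfolding I_def b_def by (rule orbit_sum_bound_configuration)
  have F: "F \<in> borel_measurable (Pi\<^sub>M I (\<lambda>_. borel))"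
    using max_linear_lipschitz[where a = "orbit_sum p n f", OF S(1,2) I(1) a]
    unfolding F_def coordinate_lipschitz_def by blast
  have indep: "prob_space.indep_vars M (\<lambda>_. borel) W I" "prob_space.indep_vars N (\<lambda>_. borel) Y I"
    using W Y by (auto simp: symmetric_array_def I_def)
  have meas[measurable]: "\<And>e. e \<in> I \<Longrightarrow> W e \<in> borel_measurable M" "\<And>e. e \<in> I \<Longrightarrow> Y e \<in> borel_measurable N"
    using symmetric_array_measurable[OF M W I(3)] symmetric_array_measurable[OF N Y I(3)] by auto
  have \<mu>: "square_integrable_laws (laws M I W)" and \<nu>: "square_integrable_laws (laws N I Y)"
    by (rule square_integrable_laws_laws[OF M meas(1) sq(1)[OF I(3)]], assumption+)
       (rule square_integrable_laws_laws[OF N meas(2) sq(2)[OF I(3)]], assumption+)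
  have tr: "(\<integral>t. h t \<partial>laws M I W i) = (\<integral>\<omega>. h (W i \<omega>) \<partial>M)" "(\<integral>t. h t \<partial>laws N I Y i) = (\<integral>\<omega>. h (Y i \<omega>) \<partial>N)"
    "integrable (laws M I W i) h = integrable M (\<lambda>\<omega>. h (W i \<omega>))"
    "integrable (laws N I Y i) h = integrable N (\<lambda>\<omega>. h (Y i \<omega>))"
    if "i \<in> I" and [measurable]: "h \<in> borel_measurable borel" for h :: "real \<Rightarrow> real" and i
    using that meas[OF that(1)] by (auto simp: laws_def integral_distr integrable_distr_eq)
  have h: "(\<lambda>t. t) \<in> borel_measurable borel" "(\<lambda>t::real. t\<^sup>2) \<in> borel_measurable borel"
    "(\<lambda>t::real. \<bar>t\<bar> ^ 3) \<in> borel_measurable borel"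
    by measurable
  have "\<bar>(\<integral>x. F x \<partial>Pi\<^sub>M I (laws M I W)) - (\<integral>x. F x \<partial>Pi\<^sub>M I (laws N I Y))\<bar>
      \<le> ln (card S) / \<beta> + card I * (\<beta> * b\<^sup>2 * e2 + \<beta>\<^sup>2 * b ^ 3 * e3)"
    unfolding F_def
  proof (rule max_linear_lindeberg[OF S(1,2) I(1) a \<mu> \<nu> \<beta>])
    fix i assume i: "i \<in> I"
    note i' = I(3)[OF i]
    show "integrable (laws M I W i) (\<lambda>t. \<bar>t\<bar> ^ 3)" unfolding tr(3)[OF i h(3)] by (rule cube(1)[OF i'])
    show "integrable (laws N I Y i) (\<lambda>t. \<bar>t\<bar> ^ 3)" unfolding tr(4)[OF i h(3)] by (rule cube(2)[OF i'])
    show "(\<integral>t. t \<partial>laws M I W i) = (\<integral>t. t \<partial>laws N I Y i)"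
      unfolding tr(1,2)[OF i h(1)] by (rule mean[OF i'])
    show "\<bar>(\<integral>t. t\<^sup>2 \<partial>laws M I W i) - (\<integral>t. t\<^sup>2 \<partial>laws N I Y i)\<bar> \<le> e2"
      unfolding tr(1,2)[OF i h(2)] by (rule second[OF i'])
    show "(\<integral>t. \<bar>t\<bar> ^ 3 \<partial>laws M I W i) + (\<integral>t. \<bar>t\<bar> ^ 3 \<partial>laws N I Y i) \<le> e3"
      unfolding tr(1,2)[OF i h(3)] by (rule third[OF i'])
  qed
  also have "\<dots> \<le> ln (card S) / \<beta> + real n ^ p * (\<beta> * b\<^sup>2 * e2 + \<beta>\<^sup>2 * b ^ 3 * e3)"
  proof -
    have "real (card I) \<le> real n ^ p"
      using card_increasing_tuples_le[of p n] unfolding I_def by (metis of_nat_le_iff of_nat_power)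
    moreover have "0 \<le> \<beta> * b\<^sup>2 * e2 + \<beta>\<^sup>2 * b ^ 3 * e3"
      using \<beta> e C by (auto simp: b_def)
    ultimately show ?thesis by (intro add_left_mono mult_right_mono)
  qed
  finally have "\<bar>(\<integral>\<omega>. F (\<lambda>e\<in>I. W e \<omega>) \<partial>M) - (\<integral>\<omega>. F (\<lambda>e\<in>I. Y e \<omega>) \<partial>N)\<bar>
      \<le> ln (card S) / \<beta> + real n ^ p * (\<beta> * b\<^sup>2 * e2 + \<beta>\<^sup>2 * b ^ 3 * e3)"
    unfolding expectation_eq_integral_laws(1)[OF M indep(1) I(2) F]
      expectation_eq_integral_laws(1)[OF N indep(2) I(2) F] .
  then have "\<bar>(\<integral>\<omega>. F (\<lambda>e\<in>I. W e \<omega>) \<partial>M) - (\<integral>\<omega>. F (\<lambda>e\<in>I. Y e \<omega>) \<partial>N)\<bar> / real n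
      \<le> (ln (card S) / \<beta> + real n ^ p * (\<beta> * b\<^sup>2 * e2 + \<beta>\<^sup>2 * b ^ 3 * e3)) / real n"
    by (rule divide_right_mono) simp
  then show ?thesis
    unfolding expectation_ground_value[OF M W] expectation_ground_value[OF N Y]
      diff_divide_distrib[symmetric] abs_divide F_def I_def b_def by simp
qed

lemma ground_value_concentration:
  assumes M: "prob_space M" and W: "symmetric_array M p n W"
    and sq: "\<And>e. e \<in> distinct_tuples p n \<Longrightarrow> integrable M (\<lambda>\<omega>. (W e \<omega>)\<^sup>2)"
    and second: "\<And>e. e \<in> distinct_tuples p n \<Longrightarrow> (\<integral>\<omega>. (W e \<omega>)\<^sup>2 \<partial>M) \<le> v"
  shows "measure M {\<omega>\<in>space M. 1 \<le> \<bar>ground_value p n f S (\<lambda>is. W is \<omega>) -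
      (\<integral>\<omega>. ground_value p n f S (\<lambda>is. W is \<omega>) \<partial>M)\<bar>}
    \<le> real n ^ p * ((real p ^ p * C)\<^sup>2 * v) / (real n)\<^sup>2"
proof -
  define I where "I = increasing_tuples p n"
  define b where "b = real p ^ p * C"
  define F where "F = max_linear S I (orbit_sum p n f)"
  have I: "finite I" "I \<noteq> {}" "\<And>e. e \<in> I \<Longrightarrow> e \<in> distinct_tuples p n"
    using finite_increasing_tuples increasing_tuples_nonempty[OF p(2)] increasing_tuples_subset
    unfolding I_def by blast+
  have a: "\<And>\<sigma> e. \<sigma> \<in> S \<Longrightarrow> e \<in> I \<Longrightarrow> \<bar>orbit_sum p n f \<sigma> e\<bar> \<le> b"
    unfolding I_def b_def by (rule orbit_sum_bound_configuration)
  have b: "0 \<le> b" using C by (simp add: b_def)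
  have n: "0 < real n" using p by simp
  have F: "coordinate_lipschitz I (\<lambda>_. b) F"
    unfolding F_def by (rule max_linear_lipschitz[OF S(1,2) I(1) a])
  have indep: "prob_space.indep_vars M (\<lambda>_. borel) W I"
    using W by (auto simp: symmetric_array_def I_def)
  let ?E = "\<integral>\<omega>. F (\<lambda>e\<in>I. W e \<omega>) \<partial>M"
  have "(1 \<le> \<bar>ground_value p n f S (\<lambda>is. W is \<omega>) - (\<integral>\<omega>. ground_value p n f S (\<lambda>is. W is \<omega>) \<partial>M)\<bar>)
      = (real n \<le> \<bar>F (\<lambda>e\<in>I. W e \<omega>) - ?E\<bar>)" if "\<omega> \<in> space M" for \<omega>
    unfolding expectation_ground_value[OF M W] ground_value_eq_max_linear[OF W that]
      diff_divide_distrib[symmetric] abs_divide F_def I_def using n by (simp add: pos_le_divide_eq)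
  then have "measure M {\<omega>\<in>space M. 1 \<le> \<bar>ground_value p n f S (\<lambda>is. W is \<omega>) -
      (\<integral>\<omega>. ground_value p n f S (\<lambda>is. W is \<omega>) \<partial>M)\<bar>}
    = measure M {\<omega>\<in>space M. real n \<le> \<bar>F (\<lambda>e\<in>I. W e \<omega>) - ?E\<bar>}"
    by (intro arg_cong[where f = "measure M"]) blast
  also have "\<dots> \<le> (\<Sum>i\<in>I. b\<^sup>2 * (\<integral>\<omega>. (W i \<omega>)\<^sup>2 \<partial>M)) / (real n)\<^sup>2"
    by (rule concentration_coordinate_lipschitz[OF M indep I(2,1) F b sq[OF I(3)] n])
  also have "\<dots> \<le> (real n ^ p * (b\<^sup>2 * v)) / (real n)\<^sup>2"
  proof (rule divide_right_mono)
    obtain e where "e \<in> I" using I(2) by blast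
    have "0 \<le> (\<integral>\<omega>. (W e \<omega>)\<^sup>2 \<partial>M)" by simp
    then have v: "0 \<le> v" using second[OF I(3)[OF \<open>e \<in> I\<close>]] by linarith
    have "(\<Sum>i\<in>I. b\<^sup>2 * (\<integral>\<omega>. (W i \<omega>)\<^sup>2 \<partial>M)) \<le> (\<Sum>i\<in>I. b\<^sup>2 * v)"
      by (intro sum_mono mult_left_mono second I(3)) auto
    also have "\<dots> = real (card I) * (b\<^sup>2 * v)" by simp
    also have "\<dots> \<le> real n ^ p * (b\<^sup>2 * v)"
    proof (rule mult_right_mono)
      show "real (card I) \<le> real n ^ p"
        using card_increasing_tuples_le[of p n] unfolding I_def by (metis of_nat_le_iff of_nat_power)
    qed (use v in simp)
    finally show "(\<Sum>i\<in>I. b\<^sup>2 * (\<integral>\<omega>. (W i \<omega>)\<^sup>2 \<partial>M)) \<le> real n ^ p * (b\<^sup>2 * v)" .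
  qed simp
  finally show ?thesis by (simp add: b_def)
qed

end

text \<open>The number \<open>q\<close> bounds the means of the entries of both arrays, the second moments of the sparse
  entries and the variances of the Gaussian ones. The sum over at most \<open>n\<^sup>p\<close> tuples divided by \<open>n\<close>
  is a factor \<open>n\<^bsup>p-1\<^esup>\<close>, which times \<open>q\<close> equals \<open>d K\<close>; each further positive power of \<open>q\<close> tends to \<open>0\<close> with
  growing \<open>n\<close>, so only the term with \<open>|B|\<close> remains in the limit.\<close>
lemma ground_value_interpolation:
  fixes f :: "'x list \<Rightarrow> real"
  assumes p: "2 \<le> p" "p \<le> n" and S: "finite S" "S \<noteq> {}" "S \<subseteq> {1..n} \<rightarrow>\<^sub>E X"
    and C: "0 \<le> C" and f: "\<And>xs. length xs = p \<Longrightarrow> set xs \<subseteq> X \<Longrightarrow> \<bar>f xs\<bar> \<le> C"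
    and k1: "symmetric_kernel p \<kappa>\<^sub>1" and k2: "symmetric_kernel p \<kappa>\<^sub>2"
    and K: "\<And>is. length is = p \<Longrightarrow> \<kappa>\<^sub>1 is \<le> K" "\<And>is. length is = p \<Longrightarrow> \<kappa>\<^sub>2 is \<le> K"
    and d: "0 < d" and A: "sparse_array M p n d \<kappa> \<kappa>\<^sub>1 \<kappa>\<^sub>2 B A" and J: "gaussian_array N p n \<kappa>\<^sub>2 J"
    and \<beta>: "0 < \<beta>"
  defines "q \<equiv> d * K / real n ^ (p - 1)" and "b \<equiv> real p ^ p * C"
  shows "\<bar>(\<integral>\<omega>. ground_value p n f S (\<lambda>is. A is \<omega>) \<partial>M) -
      (\<integral>\<omega>. ground_value p n f S (shifted_field p n d \<kappa>\<^sub>1 (\<lambda>is. J is \<omega>)) \<partial>N)\<bar>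
    \<le> ln (card S) / (real n * \<beta>) + d * K * (\<beta> * b\<^sup>2 * q + \<beta>\<^sup>2 * b ^ 3 * (\<bar>B\<bar> + 4 * q\<^sup>2 + 8 * sqrt q))"
    and "measure M {\<omega>\<in>space M. 1 \<le> \<bar>ground_value p n f S (\<lambda>is. A is \<omega>) -
      (\<integral>\<omega>. ground_value p n f S (\<lambda>is. A is \<omega>) \<partial>M)\<bar>} \<le> b\<^sup>2 * d * K / real n"
proof -
  have M: "prob_space M" and W: "symmetric_array M p n A" using A by (auto simp: sparse_array_def)
  have N: "prob_space N" and J': "symmetric_array N p n J" using J by (auto simp: gaussian_array_def)
  define R where "R = real n ^ (p - 1)"
  have n: "0 < real n" using p by simp
  have R: "0 < R" using n by (simp add: R_def)
  have np: "real n ^ p = R * real n" using p by (simp add: R_def power_eq_if)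
  define s where "s = sqrt d / real n powr ((real p - 1) / 2)"
  define m where "m e = d * \<kappa>\<^sub>1 e / R" for e
  define Y where "Y e \<omega> = shifted_field p n d \<kappa>\<^sub>1 (\<lambda>is. J is \<omega>) e" for e \<omega>
  have Y: "symmetric_array N p n Y"
    unfolding Y_def[abs_def] by (rule symmetric_array_shifted_field[OF N J' k1])
  have Y_eq: "Y e \<omega> = m e + s * J e \<omega>" for e \<omega>
    by (simp add: Y_def shifted_field_def m_def s_def R_def)
  have s0: "0 \<le> s" using d by (simp add: s_def)
  have "(real n powr ((real p - 1) / 2))\<^sup>2 = real n powr (real p - 1)"
    by (simp add: power2_eq_square powr_add[symmetric])
  also have "\<dots> = R"
    using p n powr_realpow[of "real n" "p - 1"] by (simp add: R_def of_nat_diff)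
  finally have s2: "s\<^sup>2 = d / R" using d by (simp add: s_def power_divide)
  have len: "length e = p" if "e \<in> distinct_tuples p n" for e
    using that by (simp add: distinct_tuples_def)
  have pos: "0 \<le> \<kappa>\<^sub>1 e" "0 \<le> \<kappa>\<^sub>2 e" if "e \<in> distinct_tuples p n" for e
    using k1 k2 len[OF that] by (auto simp: symmetric_kernel_def)
  obtain e0 where e0: "e0 \<in> distinct_tuples p n"
    using increasing_tuples_nonempty[OF p(2)] increasing_tuples_subset by blast
  have K0: "0 \<le> K" using pos(1)[OF e0] K(1)[OF len[OF e0]] by linarith
  have q: "q = d * K / R" by (simp add: q_def R_def)
  have q0: "0 \<le> q" using d K0 R by (simp add: q)
  have m: "0 \<le> m e" "m e \<le> q" if "e \<in> distinct_tuples p n" for e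
    using pos(1)[OF that] K(1)[OF len[OF that]] d R by (auto simp: m_def q divide_right_mono)
  have v: "d * \<kappa>\<^sub>2 e / R \<le> q" if "e \<in> distinct_tuples p n" for e
    using K(2)[OF len[OF that]] d R by (auto simp: q divide_right_mono)
  have A_meas: "A e \<in> borel_measurable M" and J_meas: "J e \<in> borel_measurable N"
    if "e \<in> distinct_tuples p n" for e
    using symmetric_array_measurable[OF M W that] symmetric_array_measurable[OF N J' that] .
  have A_B: "AE \<omega> in M. \<bar>A e \<omega>\<bar> \<le> \<bar>B\<bar>" if "e \<in> distinct_tuples p n" for e
  proof -
    have "AE \<omega> in M. \<bar>A e \<omega>\<bar> \<le> B" using A that by (auto simp: sparse_array_def)
    then show ?thesis by eventually_elim linarith
  qed
  have A1: "(\<integral>\<omega>. A e \<omega> \<partial>M) = m e" and A2: "(\<integral>\<omega>. (A e \<omega>)\<^sup>2 \<partial>M) = d * \<kappa>\<^sub>2 e / R"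
    if "e \<in> distinct_tuples p n" for e
    using A that by (auto simp: sparse_array_def m_def R_def)
  note Am = bounded_third_moment[OF M A_meas A_B]
  have J_law: "distr N borel (J e) = gaussian 0 (\<kappa>\<^sub>2 e)" if "e \<in> distinct_tuples p n" for e
    using J that by (auto simp: gaussian_array_def)
  have Ym: "(\<integral>\<omega>. Y e \<omega> \<partial>N) = m e" "integrable N (\<lambda>\<omega>. (Y e \<omega>)\<^sup>2)"
      "(\<integral>\<omega>. (Y e \<omega>)\<^sup>2 \<partial>N) = (m e)\<^sup>2 + s\<^sup>2 * \<kappa>\<^sub>2 e" "integrable N (\<lambda>\<omega>. \<bar>Y e \<omega>\<bar> ^ 3)"
      "(\<integral>\<omega>. \<bar>Y e \<omega>\<bar> ^ 3 \<partial>N) \<le> 4 * m e ^ 3 + 8 * (s * sqrt (\<kappa>\<^sub>2 e)) ^ 3"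
    if e: "e \<in> distinct_tuples p n" for e
    unfolding Y_eq
    by (rule affine_gaussian_moments[OF N J_meas[OF e] J_law[OF e] pos(2)[OF e] m(1)[OF e] s0])+
  have diff2: "\<bar>(\<integral>\<omega>. (A e \<omega>)\<^sup>2 \<partial>M) - (\<integral>\<omega>. (Y e \<omega>)\<^sup>2 \<partial>N)\<bar> \<le> q\<^sup>2" if e: "e \<in> distinct_tuples p n" for e
    unfolding A2[OF e] Ym(3)[OF e] s2 using m[OF e] by (simp add: power_mono)
  have third: "(\<integral>\<omega>. \<bar>A e \<omega>\<bar> ^ 3 \<partial>M) + (\<integral>\<omega>. \<bar>Y e \<omega>\<bar> ^ 3 \<partial>N) \<le> \<bar>B\<bar> * q + (4 * q ^ 3 + 8 * sqrt q ^ 3)"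
    if e: "e \<in> distinct_tuples p n" for e
  proof (rule add_mono)
    show "(\<integral>\<omega>. \<bar>A e \<omega>\<bar> ^ 3 \<partial>M) \<le> \<bar>B\<bar> * q"
      using Am(3)[OF e e] v[OF e] unfolding A2[OF e] by (meson abs_ge_zero mult_left_mono order_trans)
    have "(s * sqrt (\<kappa>\<^sub>2 e))\<^sup>2 \<le> q"
      using v[OF e] pos(2)[OF e] by (simp add: power_mult_distrib s2)
    then have "s * sqrt (\<kappa>\<^sub>2 e) \<le> sqrt q" by (rule real_le_rsqrt)
    then have "(s * sqrt (\<kappa>\<^sub>2 e)) ^ 3 \<le> sqrt q ^ 3"
      using s0 pos(2)[OF e] by (intro power_mono) auto
    moreover have "m e ^ 3 \<le> q ^ 3" using m[OF e] by (intro power_mono) auto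
    ultimately show "(\<integral>\<omega>. \<bar>Y e \<omega>\<bar> ^ 3 \<partial>N) \<le> 4 * q ^ 3 + 8 * sqrt q ^ 3"
      using Ym(5)[OF e] by linarith
  qed
  have p1: "1 \<le> p" using p by simp
  have "\<bar>(\<integral>\<omega>. ground_value p n f S (\<lambda>is. A is \<omega>) \<partial>M) - (\<integral>\<omega>. ground_value p n f S (\<lambda>is. Y is \<omega>) \<partial>N)\<bar>
    \<le> (ln (card S) / \<beta> + real n ^ p * (\<beta> * (real p ^ p * C)\<^sup>2 * q\<^sup>2 +
        \<beta>\<^sup>2 * (real p ^ p * C) ^ 3 * (\<bar>B\<bar> * q + (4 * q ^ 3 + 8 * sqrt q ^ 3)))) / real n"
    by (rule ground_value_comparison[OF p1 p(2) S C f M W N Y Am(1) Ym(2) Am(2) Ym(4) _ diff2 third \<beta>])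
       (use A1 Ym(1) q0 in auto)
  also have "\<dots> = ln (card S) / (real n * \<beta>) +
      (R * q) * (\<beta> * b\<^sup>2 * q + \<beta>\<^sup>2 * b ^ 3 * (\<bar>B\<bar> + 4 * q\<^sup>2 + 8 * sqrt q))"
  proof -
    have "sqrt q ^ 3 = q * sqrt q" using q0 by (simp add: power3_eq_cube)
    then show ?thesis
      unfolding np b_def[symmetric] using n \<beta> by (simp add: field_simps power2_eq_square power3_eq_cube)
  qed
  also have "R * q = d * K" using R by (simp add: q)
  finally show "\<bar>(\<integral>\<omega>. ground_value p n f S (\<lambda>is. A is \<omega>) \<partial>M) -
      (\<integral>\<omega>. ground_value p n f S (shifted_field p n d \<kappa>\<^sub>1 (\<lambda>is. J is \<omega>)) \<partial>N)\<bar>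
    \<le> ln (card S) / (real n * \<beta>) + d * K * (\<beta> * b\<^sup>2 * q + \<beta>\<^sup>2 * b ^ 3 * (\<bar>B\<bar> + 4 * q\<^sup>2 + 8 * sqrt q))"
    by (simp add: Y_def[abs_def])
  have "measure M {\<omega>\<in>space M. 1 \<le> \<bar>ground_value p n f S (\<lambda>is. A is \<omega>) -
      (\<integral>\<omega>. ground_value p n f S (\<lambda>is. A is \<omega>) \<partial>M)\<bar>} \<le> real n ^ p * ((real p ^ p * C)\<^sup>2 * q) / (real n)\<^sup>2"
    by (rule ground_value_concentration[OF p1 p(2) S C f M W Am(1)]) (use A2 v in auto)
  also have "\<dots> = b\<^sup>2 * (R * q) / real n"
    unfolding np b_def[symmetric] using n by (simp add: field_simps power2_eq_square)
  also have "\<dots> = b\<^sup>2 * d * K / real n" unfolding \<open>R * q = d * K\<close> by simp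
  finally show "measure M {\<omega>\<in>space M. 1 \<le> \<bar>ground_value p n f S (\<lambda>is. A is \<omega>) -
      (\<integral>\<omega>. ground_value p n f S (\<lambda>is. A is \<omega>) \<partial>M)\<bar>} \<le> b\<^sup>2 * d * K / real n" .
qed

section \<open>Sparse and Gaussian optimisation\<close>

theorem theorem1p1:
  fixes p :: nat
    and X :: "'x set"
    and f :: "'x list \<Rightarrow> real"
    and S :: "nat \<Rightarrow> (nat \<Rightarrow> 'x) set"
    and \<kappa> \<kappa>\<^sub>1 \<kappa>\<^sub>2 :: "nat list \<Rightarrow> real"
    and B\<^sub>U :: real
    and M :: "real \<Rightarrow> nat \<Rightarrow> 'a measure"
    and A :: "real \<Rightarrow> nat \<Rightarrow> nat list \<Rightarrow> 'a \<Rightarrow> real"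
    and N :: "nat \<Rightarrow> 'b measure"
    and J :: "nat \<Rightarrow> nat list \<Rightarrow> 'b \<Rightarrow> real"
  assumes "p \<ge> 2"
    and "finite X"
    and "symmetric_on {xs. length xs = p \<and> set xs \<subseteq> X} f"
    and "\<And>n. S n \<subseteq> ({1..n} \<rightarrow>\<^sub>E X)"
    and "symmetric_kernel p \<kappa>" and "symmetric_kernel p \<kappa>\<^sub>1" and "symmetric_kernel p \<kappa>\<^sub>2"
    and "\<And>d. d > 0 \<Longrightarrow> \<forall>\<^sub>F n in sequentially. sparse_array (M d n) p n d \<kappa> \<kappa>\<^sub>1 \<kappa>\<^sub>2 B\<^sub>U (A d n)"
    and "\<And>n. gaussian_array (N n) p n \<kappa>\<^sub>2 (J n)"
  shows "\<exists>Z :: real \<Rightarrow> nat \<Rightarrow> 'a \<Rightarrow> real.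
    small_o_sqrt_whp M Z \<and>
    (\<forall>d>0. \<forall>n\<ge>1. \<forall>\<omega>\<in>space (M d n).
       V_n p n f (S n) (\<lambda>is. A d n is \<omega>) =
       ereal_expectation (N n)
         (\<lambda>\<omega>'. SUP \<alpha>::real. ereal (\<alpha> * d) + T_n p n f (S n) \<kappa>\<^sub>1 (\<lambda>is. J n is \<omega>') \<alpha> * ereal (sqrt d))
       + ereal (Z d n \<omega>))"
proof -
  note p = assms(1) and X = assms(2) and SX = assms(4) and k1 = assms(6) and k2 = assms(7)
    and A = assms(8) and J = assms(9)
  have S_fin: "finite (S n)" for n
    by (rule finite_subset[OF SX]) (use X in \<open>auto intro: finite_PiE\<close>)
  define C where "C = (\<Sum>xs | set xs \<subseteq> X \<and> length xs = p. \<bar>f xs\<bar>)"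
  have C0: "0 \<le> C" unfolding C_def by (intro sum_nonneg) auto
  have C: "\<bar>f xs\<bar> \<le> C" if "length xs = p" "set xs \<subseteq> X" for xs
    unfolding C_def by (rule member_le_sum) (use that finite_lists_length_eq[OF X] in auto)
  obtain K1 K2 where K12: "\<And>is. length is = p \<Longrightarrow> \<kappa>\<^sub>1 is \<le> K1" "\<And>is. length is = p \<Longrightarrow> \<kappa>\<^sub>2 is \<le> K2"
    using k1 k2 unfolding symmetric_kernel_def by blast
  define K where "K = max K1 K2"
  have K: "\<And>is. length is = p \<Longrightarrow> \<kappa>\<^sub>1 is \<le> K" "\<And>is. length is = p \<Longrightarrow> \<kappa>\<^sub>2 is \<le> K"
    using K12 unfolding K_def by (auto simp: le_max_iff_disj)
  have "0 \<le> \<kappa>\<^sub>1 (replicate p 0)" using k1 by (simp add: symmetric_kernel_def)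
  then have K0: "0 \<le> K" using K(1)[of "replicate p 0"] by simp
  define b where "b = real p ^ p * C"
  define G where "G d n \<omega> = ground_value p n f (S n) (\<lambda>is. A d n is \<omega>)" for d n \<omega>
  define E where "E d n = (\<integral>\<omega>. ground_value p n f (S n) (shifted_field p n d \<kappa>\<^sub>1 (\<lambda>is. J n is \<omega>)) \<partial>N n)" for d n
  define Z where "Z d n \<omega> = (if S n = {} then 0 else G d n \<omega> - E d n)" for d n \<omega>
  \<comment> \<open>The smoothing error and the surviving third moment, both multiplied by \<open>d\<^bsup>1/3\<^esup>\<close>. Of the additional \<open>2\<close>
      in \<open>g\<close>, one unit absorbs the terms that vanish as \<open>n \<rightarrow> \<infinity>\<close> and one the random fluctuation.\<close>
  define c where "c = ln (real (card X)) + b ^ 3 * K * \<bar>B\<^sub>U\<bar>"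
  define g where "g d = c * d powr (1/3) + 2" for d
  have "0 \<le> ln (real (card X))" by (cases "card X = 0") auto
  then have g0: "0 \<le> g d" for d
    using K0 C0 by (simp add: g_def c_def b_def)
  have N: "prob_space (N n)" for n using J[of n] by (simp add: gaussian_array_def)

  have "V_n p n f (S n) (\<lambda>is. A d n is \<omega>) =
       ereal_expectation (N n)
         (\<lambda>\<omega>'. SUP \<alpha>::real. ereal (\<alpha> * d) + T_n p n f (S n) \<kappa>\<^sub>1 (\<lambda>is. J n is \<omega>') \<alpha> * ereal (sqrt d))
       + ereal (Z d n \<omega>)" if d: "0 < d" and n: "1 \<le> n" for d n \<omega>
  proof (cases "S n = {}")
    case True
    have "T_n p n f (S n) \<kappa>\<^sub>1 j \<alpha> = - \<infinity>" for j \<alpha>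
      using n by (simp add: T_n_def True bot_ereal_def)
    then have "(SUP \<alpha>::real. ereal (\<alpha> * d) + T_n p n f (S n) \<kappa>\<^sub>1 j \<alpha> * ereal (sqrt d)) = - \<infinity>" for j
      using d by simp
    moreover have "V_n p n f (S n) (\<lambda>is. A d n is \<omega>) = - \<infinity>"
      using n by (simp add: V_n_def True bot_ereal_def)
    ultimately show ?thesis by (simp add: ereal_expectation_bot[OF N])
  next
    case False
    have p1: "1 \<le> p" using p by simp
    show ?thesis
      unfolding ereal_expectation_ground_value[OF p1 n S_fin False d k2 J] V_n_eq_ground_value[OF S_fin False n]
      by (simp add: Z_def False G_def E_def)
  qed
  moreover have "small_o_sqrt_whp M Z"
    unfolding small_o_sqrt_whp_def
  proof (intro exI[of _ g] conjI)
    have "((\<lambda>d::real. d powr (-1/6)) \<longlongrightarrow> 0) at_top" "((\<lambda>d::real. d powr (-1/2)) \<longlongrightarrow> 0) at_top"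
      by (rule tendsto_neg_powr, simp, rule filterlim_ident)+
    then have "((\<lambda>d. c * d powr (-1/6) + 2 * d powr (-1/2)) \<longlongrightarrow> c * 0 + 2 * 0) at_top"
      by (intro tendsto_intros)
    moreover have "\<forall>\<^sub>F d in at_top. c * d powr (-1/6) + 2 * d powr (-1/2) = g d / sqrt d"
    proof (rule eventually_mono[OF eventually_gt_at_top[of 0]])
      fix d :: real assume d: "0 < d"
      have "1 / sqrt d = d powr (-1/2)" using d by (simp add: powr_minus_divide powr_half_sqrt[symmetric])
      then have "g d / sqrt d = g d * d powr (-1/2)" by (metis times_divide_eq_right mult.right_neutral)
      also have "\<dots> = c * (d powr (1/3) * d powr (-1/2)) + 2 * d powr (-1/2)"
        by (simp add: g_def algebra_simps)
      also have "d powr (1/3) * d powr (-1/2) = d powr (-1/6)" by (simp add: powr_add[symmetric])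
      finally show "c * d powr (-1/6) + 2 * d powr (-1/2) = g d / sqrt d" by simp
    qed
    ultimately have "((\<lambda>d. g d / sqrt d) \<longlongrightarrow> c * 0 + 2 * 0) at_top"
      by (rule Lim_transform_eventually)
    then show "((\<lambda>d. g d / sqrt d) \<longlongrightarrow> 0) at_top" by simp
  next
    show "\<forall>\<^sub>F d in at_top. (\<lambda>n. measure (M d n) {\<omega>\<in>space (M d n). \<bar>Z d n \<omega>\<bar> \<le> g d}) \<longlonglongrightarrow> 1"
    proof (rule eventually_mono[OF eventually_gt_at_top[of 0]])
      fix d :: real assume d: "0 < d"
      \<comment> \<open>This choice balances the smoothing error \<open>1 / \<beta>\<close> against the replacement error \<open>\<beta>\<^sup>2 d\<close>.\<close>
      define \<beta> where "\<beta> = d powr (-1/3)"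
      have \<beta>: "0 < \<beta>" using d by (simp add: \<beta>_def)
      have inv_\<beta>: "1 / \<beta> = d powr (1/3)" using d by (simp add: \<beta>_def powr_minus_divide)
      have "\<beta>\<^sup>2 * d = d powr (-1/3) * d powr (-1/3) * d powr 1"
        using d by (simp add: \<beta>_def power2_eq_square)
      then have \<beta>2: "\<beta>\<^sup>2 * d = d powr (1/3)" unfolding powr_add[symmetric] by simp
      define q where "q n = d * K / real n ^ (p - 1)" for n :: nat
      define h where "h n = d * K * (\<beta> * b\<^sup>2 * q n + \<beta>\<^sup>2 * b ^ 3 * (\<bar>B\<^sub>U\<bar> + 4 * (q n)\<^sup>2 + 8 * sqrt (q n)))" for n
      have "q \<longlonglongrightarrow> 0"
      proof -
        have "filterlim (\<lambda>n. real n ^ (p - 1)) at_top sequentially"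
          by (rule filterlim_pow_at_top) (use p filterlim_real_sequentially in auto)
        then show ?thesis unfolding q_def[abs_def]
          by (intro tendsto_divide_0[OF tendsto_const] filterlim_at_top_imp_at_infinity)
      qed
      then have "h \<longlonglongrightarrow> d * K * (\<beta> * b\<^sup>2 * 0 + \<beta>\<^sup>2 * b ^ 3 * (\<bar>B\<^sub>U\<bar> + 4 * 0\<^sup>2 + 8 * sqrt 0))"
        unfolding h_def[abs_def] by (intro tendsto_intros)
      moreover have "d * K * (\<beta> * b\<^sup>2 * 0 + \<beta>\<^sup>2 * b ^ 3 * (\<bar>B\<^sub>U\<bar> + 4 * 0\<^sup>2 + 8 * sqrt 0))
          = b ^ 3 * K * \<bar>B\<^sub>U\<bar> * d powr (1/3)"
        unfolding \<beta>2[symmetric] by simp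
      ultimately have "h \<longlonglongrightarrow> b ^ 3 * K * \<bar>B\<^sub>U\<bar> * d powr (1/3)" by (simp only:)
      then have h: "\<forall>\<^sub>F n in sequentially. h n < b ^ 3 * K * \<bar>B\<^sub>U\<bar> * d powr (1/3) + 1"
        by (rule order_tendstoD(2)) simp
      have bounds: "\<forall>\<^sub>F n in sequentially.
          1 - \<bar>b\<^sup>2 * d * K\<bar> / real n \<le> measure (M d n) {\<omega>\<in>space (M d n). \<bar>Z d n \<omega>\<bar> \<le> g d}
          \<and> measure (M d n) {\<omega>\<in>space (M d n). \<bar>Z d n \<omega>\<bar> \<le> g d} \<le> 1"
        using h A[OF d] eventually_ge_at_top[of p]
      proof eventually_elim
        case (elim n)
        interpret P: prob_space "M d n" using elim(2) by (simp add: sparse_array_def)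
        have n1: "1 \<le> n" using elim(3) p by simp
        show ?case
        proof (cases "S n = {}")
          case True
          then have "{\<omega>\<in>space (M d n). \<bar>Z d n \<omega>\<bar> \<le> g d} = space (M d n)"
            using g0 by (auto simp: Z_def)
          then show ?thesis by (simp add: P.prob_space)
        next
          case False
          obtain \<sigma> where "\<sigma> \<in> S n" using False by blast
          then have "\<sigma> 1 \<in> X" using SX[of n] n1 by (intro PiE_mem[of \<sigma> "{1..n}"]) auto
          then have "X \<noteq> {}" by blast
          then have X1: "1 \<le> card X" using X by (simp add: Suc_leI card_gt_0_iff)
          note I = ground_value_interpolation[where f = f, OF p elim(3) S_fin False SX C0 C k1 k2 K d elim(2) J \<beta>,
              folded G_def E_def b_def q_def]
          have "card (S n) \<le> card X ^ n"
            using card_mono[OF _ SX[of n]] X by (simp add: card_PiE finite_PiE)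
          then have "real (card (S n)) \<le> real (card X) ^ n" by (metis of_nat_le_iff of_nat_power)
          then have "ln (card (S n)) \<le> ln (real (card X) ^ n)"
            using False S_fin[of n] X1 X by (subst ln_le_cancel_iff) (auto simp: card_gt_0_iff)
          also have "\<dots> = n * ln (card X)" using X1 by (simp add: ln_realpow)
          finally have "ln (card (S n)) / (real n * \<beta>) \<le> n * ln (card X) / (real n * \<beta>)"
            using \<beta> by (intro divide_right_mono) auto
          also have "\<dots> = ln (card X) * d powr (1/3)"
            unfolding inv_\<beta>[symmetric] using n1 by simp
          finally have gap: "\<bar>(\<integral>\<omega>. G d n \<omega> \<partial>M d n) - E d n\<bar> \<le> g d - 1"
            using I(1) elim(1) unfolding h_def g_def c_def by (simp add: distrib_right)
          have meas[measurable]: "G d n \<in> borel_measurable (M d n)"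
            unfolding G_def[abs_def]
            by (rule measurable_ground_value[OF S_fin False symmetric_array_measurable[OF P.prob_space_axioms]])
               (use elim(2) in \<open>auto simp: sparse_array_def\<close>)
          let ?B = "{\<omega>\<in>space (M d n). 1 \<le> \<bar>G d n \<omega> - (\<integral>\<omega>. G d n \<omega> \<partial>M d n)\<bar>}"
          have "1 - \<bar>b\<^sup>2 * d * K\<bar> / real n \<le> 1 - P.prob ?B"
            using I(2) divide_right_mono[OF abs_ge_self[of "b\<^sup>2 * d * K"], of "real n"] by simp
          also have "\<dots> = P.prob (space (M d n) - ?B)"
            by (rule P.prob_compl[symmetric]) measurable
          also have "\<dots> \<le> P.prob {\<omega>\<in>space (M d n). \<bar>Z d n \<omega>\<bar> \<le> g d}"
          proof (rule P.finite_measure_mono)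
            show "space (M d n) - ?B \<subseteq> {\<omega>\<in>space (M d n). \<bar>Z d n \<omega>\<bar> \<le> g d}"
              using gap False by (auto simp: Z_def)
            have "(\<lambda>\<omega>. Z d n \<omega>) \<in> borel_measurable (M d n)"
              unfolding Z_def using False by simp
            then show "{\<omega>\<in>space (M d n). \<bar>Z d n \<omega>\<bar> \<le> g d} \<in> P.events" by measurable
          qed
          finally show ?thesis by simp
        qed
      qed
      show "(\<lambda>n. measure (M d n) {\<omega>\<in>space (M d n). \<bar>Z d n \<omega>\<bar> \<le> g d}) \<longlonglongrightarrow> 1"
      proof (rule tendsto_sandwich)
        show "\<forall>\<^sub>F n in sequentially. 1 - \<bar>b\<^sup>2 * d * K\<bar> / real n \<le>
            measure (M d n) {\<omega>\<in>space (M d n). \<bar>Z d n \<omega>\<bar> \<le> g d}"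
          using bounds by eventually_elim simp
        show "\<forall>\<^sub>F n in sequentially. measure (M d n) {\<omega>\<in>space (M d n). \<bar>Z d n \<omega>\<bar> \<le> g d} \<le> 1"
          using bounds by eventually_elim simp
        have "(\<lambda>n. 1 - \<bar>b\<^sup>2 * d * K\<bar> / real n) \<longlonglongrightarrow> 1 - 0"
          by (intro tendsto_intros lim_const_over_n)
        then show "(\<lambda>n. 1 - \<bar>b\<^sup>2 * d * K\<bar> / real n) \<longlonglongrightarrow> 1" by simp
      qed simp
    qed
  qed
  ultimately show ?thesis by blast
qed

end
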